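(* Let $S$ be an inverse $\wedge$-semigroup (with zero). Then there is a distributive inverse $\wedge$-semigroup $\mathsf{D}(S)$ and a $0$-restricted cover-to-join homomorphism $\delta \colon S \rightarrow \mathsf{D}(S)$ having the following universal property: for every cover-to-join homomorphism $\theta \colon S \rightarrow T$ to an arbitrary distributive inverse semigroup $T$ there is a unique join-preserving homomorphism $\bar{\theta} \colon \mathsf{D}(S) \rightarrow T$ such that $\bar{\theta}\delta = \theta$.
   Context: All inverse semigroups have a zero $0$. The order is the natural partial order: $s \le t$ iff $s = te$ for some idempotent $e$. $S$ is an inverse $\wedge$-semigroup if each pair of elements $s,t$ has a meet $s\wedge t$ in this order. For $s\in S$, $s^{\downarrow}=\{x\in S : x\le s\}$. Elements $s,t$ are compatible if $s^{-1}t$ and $st^{-1}$ are both idempotents; a subset is compatible if each pair of its elements is compatible. An inverse semigroup is distributive if every finite non-empty compatible subset has a join, and whenever $\{a_1,\ldots,a_m\}$ is a non-empty finite compatible subset and $a$ is any element, both $\bigvee_i aa_i$ and $\bigvee_i a_i a$ exist and $a(\bigvee_i a_i)=\bigvee_i aa_i$, $(\bigvee_i a_i)a=\bigvee_i a_ia$. (No meets are assumed in $T$.) The join of the empty set is $0$. A homomorphism between distributive inverse semigroups is join-preserving if it preserves joins of finite compatible subsets. For $a,a_1,\ldots,a_m\in S$ write $a\rightarrow\{a_1,\ldots,a_m\}$ if for each non-zero $x\le a$ we have $x\wedge a_i\ne 0$ for some $i$. A finite subset $A\subseteq a^{\downarrow}$ is a cover of $a$ if $a\rightarrow A$ (so the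 empty set is a cover of $0$). A homomorphism $\theta\colon S\to T$ from an inverse $\wedge$-semigroup to a distributive inverse semigroup is cover-to-join if for each $s\in S$ and each finite cover $A$ of $s$ we have $\theta(s)=\bigvee\theta(A)$. A homomorphism $\theta$ between inverse semigroups with zero is $0$-restricted if $\theta(s)=0$ implies $s=0$. *)

theory Defs
  imports "HOL-Algebra.Congruence" "HOL-Library.FuncSet"
begin

record 'a zsemigroup = "'a partial_object" +
  sg_mult :: "['a, 'a] \<Rightarrow> 'a" (infixl "\<cdot>\<index>" 70)
  sg_zero :: 'a ("\<zero>\<index>")

locale inverse_semigroup =
  fixes S :: "'a zsemigroup" (structure)
  assumes mult_closed: "\<lbrakk>s \<in> carrier S; t \<in> carrier S\<rbrakk> \<Longrightarrow> s \<cdot> t \<in> carrier S"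
    and mult_assoc:
      "\<lbrakk>s \<in> carrier S; t \<in> carrier S; u \<in> carrier S\<rbrakk> \<Longrightarrow> (s \<cdot> t) \<cdot> u = s \<cdot> (t \<cdot> u)"
    and zero_closed: "\<zero> \<in> carrier S"
    and zero_left: "s \<in> carrier S \<Longrightarrow> \<zero> \<cdot> s = \<zero>"
    and zero_right: "s \<in> carrier S \<Longrightarrow> s \<cdot> \<zero> = \<zero>"
    and ex1_inverse:
      "s \<in> carrier S \<Longrightarrow> \<exists>!t. t \<in> carrier S \<and> s \<cdot> t \<cdot> s = s \<and> t \<cdot> s \<cdot> t = t"

definition sg_inv :: "'a zsemigroup \<Rightarrow> 'a \<Rightarrow> 'a" where
  "sg_inv S s = (THE t. t \<in> carrier S \<and>
     s \<cdot>\<^bsub>S\<^esub> t \<cdot>\<^bsub>S\<^esub> s = s \<and> t \<cdot>\<^bsub>S\<^esub> s \<cdot>\<^bsub>S\<^esub> t = t)"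

definition idems :: "'a zsemigroup \<Rightarrow> 'a set" where
  "idems S = {e \<in> carrier S. e \<cdot>\<^bsub>S\<^esub> e = e}"

definition nat_le :: "'a zsemigroup \<Rightarrow> 'a \<Rightarrow> 'a \<Rightarrow> bool" where
  "nat_le S s t \<longleftrightarrow> (\<exists>e \<in> idems S. s = t \<cdot>\<^bsub>S\<^esub> e)"

definition down :: "'a zsemigroup \<Rightarrow> 'a \<Rightarrow> 'a set" where
  "down S s = {x \<in> carrier S. nat_le S x s}"

definition is_meet :: "'a zsemigroup \<Rightarrow> 'a \<Rightarrow> 'a \<Rightarrow> 'a \<Rightarrow> bool" where
  "is_meet S s t m \<longleftrightarrow> m \<in> carrier S \<and> nat_le S m s \<and> nat_le S m t \<and>
     (\<forall>x \<in> carrier S. nat_le S x s \<and> nat_le S x t \<longrightarrow> nat_le S x m)"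

definition meet :: "'a zsemigroup \<Rightarrow> 'a \<Rightarrow> 'a \<Rightarrow> 'a" where
  "meet S s t = (THE m. is_meet S s t m)"

locale inverse_meet_semigroup = inverse_semigroup +
  assumes ex_meet: "\<lbrakk>s \<in> carrier S; t \<in> carrier S\<rbrakk> \<Longrightarrow> \<exists>m. is_meet S s t m"

text \<open>Since \<open>\<zero> = s \<cdot> \<zero>\<close>, zero is the least element, so that
  the join of the empty set in the following sense is zero.\<close>

definition is_join :: "'a zsemigroup \<Rightarrow> 'a set \<Rightarrow> 'a \<Rightarrow> bool" where
  "is_join S A j \<longleftrightarrow> j \<in> carrier S \<and> (\<forall>a \<in> A. nat_le S a j) \<and>
     (\<forall>x \<in> carrier S. (\<forall>a \<in> A. nat_le S a x) \<longrightarrow> nat_le S j x)"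

definition compatible :: "'a zsemigroup \<Rightarrow> 'a set \<Rightarrow> bool" where
  "compatible S A \<longleftrightarrow> A \<subseteq> carrier S \<and>
     (\<forall>s \<in> A. \<forall>t \<in> A. sg_inv S s \<cdot>\<^bsub>S\<^esub> t \<in> idems S \<and> s \<cdot>\<^bsub>S\<^esub> sg_inv S t \<in> idems S)"

locale distributive_inverse_semigroup = inverse_semigroup +
  assumes ex_join: "\<lbrakk>finite A; A \<noteq> {}; compatible S A\<rbrakk> \<Longrightarrow> \<exists>j. is_join S A j"
    and distrib_left: "\<lbrakk>finite A; A \<noteq> {}; compatible S A; a \<in> carrier S; is_join S A j\<rbrakk>
      \<Longrightarrow> is_join S ((\<lambda>x. a \<cdot> x) ` A) (a \<cdot> j)"
    and distrib_right: "\<lbrakk>finite A; A \<noteq> {}; compatible S A; a \<in> carrier S; is_join S A j\<rbrakk>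
      \<Longrightarrow> is_join S ((\<lambda>x. x \<cdot> a) ` A) (j \<cdot> a)"

definition arrow :: "'a zsemigroup \<Rightarrow> 'a \<Rightarrow> 'a set \<Rightarrow> bool" where
  "arrow S a A \<longleftrightarrow> (\<forall>x \<in> down S a. x \<noteq> \<zero>\<^bsub>S\<^esub> \<longrightarrow> (\<exists>b \<in> A. meet S x b \<noteq> \<zero>\<^bsub>S\<^esub>))"

definition is_cover :: "'a zsemigroup \<Rightarrow> 'a \<Rightarrow> 'a set \<Rightarrow> bool" where
  "is_cover S a A \<longleftrightarrow> finite A \<and> A \<subseteq> down S a \<and> arrow S a A"

definition sg_hom :: "'a zsemigroup \<Rightarrow> 'b zsemigroup \<Rightarrow> ('a \<Rightarrow> 'b) \<Rightarrow> bool" where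
  "sg_hom S T \<theta> \<longleftrightarrow> \<theta> \<in> carrier S \<rightarrow> carrier T \<and>
     (\<forall>s \<in> carrier S. \<forall>t \<in> carrier S. \<theta> (s \<cdot>\<^bsub>S\<^esub> t) = \<theta> s \<cdot>\<^bsub>T\<^esub> \<theta> t)"

definition zero_restricted :: "'a zsemigroup \<Rightarrow> 'b zsemigroup \<Rightarrow> ('a \<Rightarrow> 'b) \<Rightarrow> bool" where
  "zero_restricted S T \<theta> \<longleftrightarrow> (\<forall>s \<in> carrier S. \<theta> s = \<zero>\<^bsub>T\<^esub> \<longrightarrow> s = \<zero>\<^bsub>S\<^esub>)"

definition cover_to_join_hom :: "'a zsemigroup \<Rightarrow> 'b zsemigroup \<Rightarrow> ('a \<Rightarrow> 'b) \<Rightarrow> bool" where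
  "cover_to_join_hom S T \<theta> \<longleftrightarrow> sg_hom S T \<theta> \<and>
     (\<forall>s \<in> carrier S. \<forall>A. is_cover S s A \<longrightarrow> is_join T (\<theta> ` A) (\<theta> s))"

text \<open>The empty set is included below, so a join-preserving homomorphism preserves zero.\<close>

definition join_preserving_hom :: "'a zsemigroup \<Rightarrow> 'b zsemigroup \<Rightarrow> ('a \<Rightarrow> 'b) \<Rightarrow> bool" where
  "join_preserving_hom S T \<theta> \<longleftrightarrow> sg_hom S T \<theta> \<and>
     (\<forall>A j. finite A \<and> compatible S A \<and> is_join S A j \<longrightarrow> is_join T (\<theta> ` A) (\<theta> j))"

text \<open>The universal property quantifies over distributive inverse semigroups of arbitrary size.
  HOL has no type quantifier below an existential quantifier; an object obtained from an
  existential statement could depend on the type of the target. The completion and the map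
  into it are therefore given explicitly, so that they depend on \<open>S\<close> only.

  An element of the completion is the closure, under the arrow relation, of a finite subset
  \<open>A\<close> of \<open>S\<close>, with \<open>A\<close> compatible up to covers: \<open>s\<inverse>t\<close> and \<open>st\<inverse>\<close> need not be
  idempotent for \<open>s, t\<close> in \<open>A\<close>, but only satisfy \<open>s\<inverse>t \<rightarrow> E\<close> and \<open>st\<inverse> \<rightarrow> E\<close> for
  finite sets \<open>E\<close> of idempotents. Compatibility of \<open>A\<close> itself would be too strong: an element
  which is not idempotent can be identified with an idempotent by every cover-to-join map,
  so joins would be missing.\<close>

definition arrow_closure :: "'a zsemigroup \<Rightarrow> 'a set \<Rightarrow> 'a set" where
  "arrow_closure S A = {s \<in> carrier S. \<exists>F. finite F \<and> F \<subseteq> A \<and> arrow S s F}"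

definition idem_up_to_cover :: "'a zsemigroup \<Rightarrow> 'a \<Rightarrow> bool" where
  "idem_up_to_cover S s \<longleftrightarrow> (\<exists>E. finite E \<and> E \<subseteq> idems S \<and> arrow S s E)"

definition compatible_up_to_cover :: "'a zsemigroup \<Rightarrow> 'a set \<Rightarrow> bool" where
  "compatible_up_to_cover S A \<longleftrightarrow> A \<subseteq> carrier S \<and>
     (\<forall>s \<in> A. \<forall>t \<in> A. idem_up_to_cover S (sg_inv S s \<cdot>\<^bsub>S\<^esub> t) \<and>
        idem_up_to_cover S (s \<cdot>\<^bsub>S\<^esub> sg_inv S t))"

definition distr_completion :: "'a zsemigroup \<Rightarrow> 'a set zsemigroup" where
  "distr_completion S =
     \<lparr>carrier = {arrow_closure S A | A. finite A \<and> compatible_up_to_cover S A},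
      sg_mult = (\<lambda>X Y. arrow_closure S {x \<cdot>\<^bsub>S\<^esub> y | x y. x \<in> X \<and> y \<in> Y}),
      sg_zero = {\<zero>\<^bsub>S\<^esub>}\<rparr>"

definition completion_map :: "'a zsemigroup \<Rightarrow> 'a \<Rightarrow> 'a set" where
  "completion_map S s = arrow_closure S {s}"

end

theory Submission
  imports Defs
begin

text \<open>The arrow closure is a closure operator with \<open>cl (cl X cl Y) = cl (XY)\<close> and
  \<open>cl (X\<inverse>) = (cl X)\<inverse>\<close>. Let \<open>Q\<close> be the closure of the set of idempotents. Compatibility up to covers of
  \<open>X\<close> says that \<open>X\<inverse>X\<close> and \<open>XX\<inverse>\<close> lie in \<open>Q\<close>, and products of a closed set with elements of \<open>Q\<close> stay in
  that set. Hence the completion is regular, its idempotents are its elements inside \<open>Q\<close>, they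
  multiply by intersection and so commute, and the natural order is inclusion: meets are
  intersections and joins are closures of unions.

  If \<open>u\<close> is in \<open>Q\<close>, then the largest idempotent below \<open>u\<close> covers \<open>u\<close>, so a cover-to-join map \<open>\<theta>\<close>
  sends \<open>u\<close> to an idempotent. Therefore \<open>\<theta>\<close> sends sets that are compatible up to covers to
  compatible sets, and the extension of \<open>\<theta>\<close> takes \<open>X\<close> to the join of \<open>\<theta>(X)\<close>.\<close>

section \<open>Inverse semigroups\<close>

notation sg_inv ("_\<^sup>\<star>\<index>" [1000] 1000)
notation nat_le (infix "\<preceq>\<index>" 50)

text \<open>For two inverses \<open>y\<close>, \<open>z\<close> of \<open>s\<close>, swapping
  \<open>ys\<close> with \<open>zs\<close> and then \<open>sy\<close> with \<open>sz\<close> gives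
  \<open>y = zsy = z\<close>. Uniqueness of inverses is thus reduced to commuting idempotents, which
  is what can be checked in the completion.\<close>

lemma inverse_semigroupI:
  fixes S :: "'a zsemigroup" (structure)
  assumes closed: "\<And>s t. \<lbrakk>s \<in> carrier S; t \<in> carrier S\<rbrakk> \<Longrightarrow> s \<cdot> t \<in> carrier S"
    and assoc: "\<And>s t u. \<lbrakk>s \<in> carrier S; t \<in> carrier S; u \<in> carrier S\<rbrakk> \<Longrightarrow> (s \<cdot> t) \<cdot> u = s \<cdot> (t \<cdot> u)"
    and zero: "\<zero> \<in> carrier S" "\<And>s. s \<in> carrier S \<Longrightarrow> \<zero> \<cdot> s = \<zero>" "\<And>s. s \<in> carrier S \<Longrightarrow> s \<cdot> \<zero> = \<zero>"
    and regular: "\<And>s. s \<in> carrier S \<Longrightarrow> \<exists>t \<in> carrier S. s \<cdot> t \<cdot> s = s \<and> t \<cdot> s \<cdot> t = t"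
    and commute: "\<And>e f. \<lbrakk>e \<in> idems S; f \<in> idems S\<rbrakk> \<Longrightarrow> e \<cdot> f = f \<cdot> e"
  shows "inverse_semigroup S"
proof
  fix s assume s: "s \<in> carrier S"
  have unique: "y = z" if y: "y \<in> carrier S" "s \<cdot> y \<cdot> s = s" "y \<cdot> s \<cdot> y = y"
    and z: "z \<in> carrier S" "s \<cdot> z \<cdot> s = s" "z \<cdot> s \<cdot> z = z" for y z
  proof -
    have idem: "y \<cdot> s \<in> idems S" "s \<cdot> y \<in> idems S" "z \<cdot> s \<in> idems S" "s \<cdot> z \<in> idems S"
      using s y z unfolding idems_def by (auto simp: closed) (metis assoc closed)+
    have "y = (y \<cdot> s) \<cdot> (z \<cdot> s) \<cdot> y"
      using s y z by (metis assoc closed)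
    also have "\<dots> = (z \<cdot> s) \<cdot> (y \<cdot> s) \<cdot> y"
      using commute idem by simp
    also have "\<dots> = z \<cdot> (s \<cdot> y)"
      using s y z by (metis assoc closed)
    also have "\<dots> = z \<cdot> ((s \<cdot> z) \<cdot> (s \<cdot> y))"
      using s y z by (metis assoc closed)
    also have "\<dots> = z \<cdot> ((s \<cdot> y) \<cdot> (s \<cdot> z))"
      using commute idem by simp
    also have "\<dots> = z"
      using s y z by (metis assoc closed)
    finally show ?thesis .
  qed
  show "\<exists>!t. t \<in> carrier S \<and> s \<cdot> t \<cdot> s = s \<and> t \<cdot> s \<cdot> t = t"
    using regular[OF s] unique by blast
qed (use assms in auto)

context inverse_semigroup
begin

declare mult_closed [simp, intro] zero_closed [simp] zero_left [simp] zero_right [simp]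

lemma inv_inverts:
  assumes "s \<in> carrier S"
  shows "s\<^sup>\<star> \<in> carrier S \<and> s \<cdot> s\<^sup>\<star> \<cdot> s = s \<and> s\<^sup>\<star> \<cdot> s \<cdot> s\<^sup>\<star> = s\<^sup>\<star>"
  unfolding sg_inv_def by (rule theI') (rule ex1_inverse[OF assms])

lemma inv_closed [simp, intro]: "s \<in> carrier S \<Longrightarrow> s\<^sup>\<star> \<in> carrier S"
  using inv_inverts by blast

lemma mult_inv_mult [simp]: "s \<in> carrier S \<Longrightarrow> s \<cdot> (s\<^sup>\<star> \<cdot> s) = s"
  using inv_inverts[of s] by (simp add: mult_assoc)

lemma inv_mult_inv [simp]: "s \<in> carrier S \<Longrightarrow> s\<^sup>\<star> \<cdot> (s \<cdot> s\<^sup>\<star>) = s\<^sup>\<star>"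
  using inv_inverts[of s] by (simp add: mult_assoc)

lemma mult_inv_mult_left [simp]:
  "\<lbrakk>s \<in> carrier S; t \<in> carrier S\<rbrakk> \<Longrightarrow> s \<cdot> (s\<^sup>\<star> \<cdot> (s \<cdot> t)) = s \<cdot> t"
  by (metis inv_inverts mult_assoc mult_closed)

lemma inv_mult_inv_left [simp]:
  "\<lbrakk>s \<in> carrier S; t \<in> carrier S\<rbrakk> \<Longrightarrow> s\<^sup>\<star> \<cdot> (s \<cdot> (s\<^sup>\<star> \<cdot> t)) = s\<^sup>\<star> \<cdot> t"
  by (metis inv_inverts mult_assoc mult_closed)

lemma inv_unique:
  assumes "s \<in> carrier S" "t \<in> carrier S" "s \<cdot> t \<cdot> s = s" "t \<cdot> s \<cdot> t = t"
  shows "s\<^sup>\<star> = t"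
  using ex1_inverse[of s] inv_inverts[of s] assms by blast

lemma inv_inv [simp]: "s \<in> carrier S \<Longrightarrow> s\<^sup>\<star>\<^sup>\<star> = s"
  using inv_inverts by (intro inv_unique) auto

section \<open>Idempotents and their commutation\<close>

lemma idems_closed [simp]: "e \<in> idems S \<Longrightarrow> e \<in> carrier S"
  and idems_idem [simp]: "e \<in> idems S \<Longrightarrow> e \<cdot> e = e"
  by (auto simp: idems_def)

lemma idems_idem_left [simp]: "\<lbrakk>e \<in> idems S; t \<in> carrier S\<rbrakk> \<Longrightarrow> e \<cdot> (e \<cdot> t) = e \<cdot> t"
  by (metis idems_closed idems_idem mult_assoc)

lemma idemsI: "\<lbrakk>e \<in> carrier S; e \<cdot> e = e\<rbrakk> \<Longrightarrow> e \<in> idems S"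
  unfolding idems_def by blast

lemma zero_idem [simp]: "\<zero> \<in> idems S"
  by (rule idemsI) auto

lemma inv_idem [simp]: "e \<in> idems S \<Longrightarrow> e\<^sup>\<star> = e"
  by (intro inv_unique) auto

text \<open>If \<open>x\<close> is the inverse of \<open>ef\<close>, then \<open>fxe\<close> is also
  an inverse of \<open>ef\<close>, so \<open>x = fxe\<close>, from which \<open>xx = x\<close>
  follows. Hence \<open>ef\<close> is the inverse of an idempotent. Commutation cannot be used here,
  as it is deduced from this fact.\<close>

lemma idem_mult_idem [simp]:
  assumes e: "e \<in> idems S" and f: "f \<in> idems S"
  shows "e \<cdot> f \<in> idems S"
proof -
  define x where "x = (e \<cdot> f)\<^sup>\<star>"
  have c [simp]: "e \<in> carrier S" "f \<in> carrier S" "x \<in> carrier S"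
    using e f by (auto simp: x_def)
  have x: "e \<cdot> (f \<cdot> (x \<cdot> (e \<cdot> f))) = e \<cdot> f" "x \<cdot> (e \<cdot> (f \<cdot> x)) = x"
    using inv_inverts[of "e \<cdot> f"] by (simp_all add: x_def[symmetric] mult_assoc)
  have x_left: "x \<cdot> (e \<cdot> (f \<cdot> (x \<cdot> t))) = x \<cdot> t" if "t \<in> carrier S" for t
    using x(2) that by (metis c mult_assoc mult_closed)
  have "x = f \<cdot> (x \<cdot> e)"
    unfolding x_def
    by (rule inv_unique) (use e f x x_left in \<open>simp_all add: mult_assoc flip: x_def\<close>)
  then have "x \<cdot> x = (f \<cdot> (x \<cdot> e)) \<cdot> (f \<cdot> (x \<cdot> e))"
    by simp
  also have "\<dots> = f \<cdot> (x \<cdot> e)"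
    using x_left by (simp add: mult_assoc)
  finally have "x \<in> idems S"
    using \<open>x = f \<cdot> (x \<cdot> e)\<close> by (intro idemsI) auto
  moreover have "e \<cdot> f = x\<^sup>\<star>"
    by (simp add: x_def)
  ultimately show ?thesis
    by simp
qed

text \<open>\<open>fe\<close> satisfies the equations for an inverse of \<open>ef\<close>, and the
  idempotent \<open>ef\<close> is its own inverse.\<close>

lemma idems_commute:
  assumes e: "e \<in> idems S" and f: "f \<in> idems S"
  shows "e \<cdot> f = f \<cdot> e"
proof -
  have *: "e \<cdot> (f \<cdot> (e \<cdot> f)) = e \<cdot> f" if "e \<in> idems S" "f \<in> idems S" for e f
    using idems_idem[OF idem_mult_idem[OF that]] that by (simp only: mult_assoc idems_closed mult_closed)
  then have "(e \<cdot> f)\<^sup>\<star> = f \<cdot> e"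
    using e f *[OF e f] *[OF f e] by (intro inv_unique) (auto simp: mult_assoc)
  then show ?thesis
    using e f by simp
qed

lemma inv_mult_idem [simp]: "s \<in> carrier S \<Longrightarrow> s\<^sup>\<star> \<cdot> s \<in> idems S"
  by (rule idemsI) (auto simp: mult_assoc)

lemma mult_inv_idem [simp]: "s \<in> carrier S \<Longrightarrow> s \<cdot> s\<^sup>\<star> \<in> idems S"
  by (rule idemsI) (auto simp: mult_assoc)

lemma inv_mult:
  assumes s: "s \<in> carrier S" and t: "t \<in> carrier S"
  shows "(s \<cdot> t)\<^sup>\<star> = t\<^sup>\<star> \<cdot> s\<^sup>\<star>"
proof (rule inv_unique)
  \<comment> \<open>The idempotents \<open>tt\<inverse>\<close> and \<open>s\<inverse>s\<close>
    stand side by side; once swapped, they are absorbed by the outer factors.\<close>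
  have "s \<cdot> (t \<cdot> t\<^sup>\<star> \<cdot> (s\<^sup>\<star> \<cdot> s)) \<cdot> t = s \<cdot> (s\<^sup>\<star> \<cdot> s \<cdot> (t \<cdot> t\<^sup>\<star>)) \<cdot> t"
    using s t by (simp add: idems_commute)
  then show "s \<cdot> t \<cdot> (t\<^sup>\<star> \<cdot> s\<^sup>\<star>) \<cdot> (s \<cdot> t) = s \<cdot> t"
    using s t by (simp add: mult_assoc)
  have "t\<^sup>\<star> \<cdot> (s\<^sup>\<star> \<cdot> s \<cdot> (t \<cdot> t\<^sup>\<star>)) \<cdot> s\<^sup>\<star> = t\<^sup>\<star> \<cdot> (t \<cdot> t\<^sup>\<star> \<cdot> (s\<^sup>\<star> \<cdot> s)) \<cdot> s\<^sup>\<star>"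
    using s t by (simp add: idems_commute)
  then show "t\<^sup>\<star> \<cdot> s\<^sup>\<star> \<cdot> (s \<cdot> t) \<cdot> (t\<^sup>\<star> \<cdot> s\<^sup>\<star>) = t\<^sup>\<star> \<cdot> s\<^sup>\<star>"
    using s t by (simp add: mult_assoc)
qed (use s t in auto)

lemma conj_idem:
  assumes s: "s \<in> carrier S" and e: "e \<in> idems S"
  shows "s \<cdot> e \<cdot> s\<^sup>\<star> \<in> idems S"
proof (rule idemsI)
  have "s \<cdot> (e \<cdot> (s\<^sup>\<star> \<cdot> s)) \<cdot> (e \<cdot> s\<^sup>\<star>) = s \<cdot> (s\<^sup>\<star> \<cdot> s \<cdot> e) \<cdot> (e \<cdot> s\<^sup>\<star>)"
    using s e by (simp add: idems_commute)
  then show "s \<cdot> e \<cdot> s\<^sup>\<star> \<cdot> (s \<cdot> e \<cdot> s\<^sup>\<star>) = s \<cdot> e \<cdot> s\<^sup>\<star>"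
    using s e by (simp add: mult_assoc)
qed (use s e in auto)

text \<open>An idempotent passes through \<open>s\<close> at the cost of a conjugation. With the
  mirror version below, this makes the order, which is defined by right multiplication, symmetric in
  left and right.\<close>

lemma mult_idem_eq:
  assumes s: "s \<in> carrier S" and e: "e \<in> idems S"
  shows "s \<cdot> e = (s \<cdot> e \<cdot> s\<^sup>\<star>) \<cdot> s"
proof -
  have "s \<cdot> (s\<^sup>\<star> \<cdot> s \<cdot> e) = s \<cdot> (e \<cdot> (s\<^sup>\<star> \<cdot> s))"
    using s e by (simp add: idems_commute)
  then show ?thesis
    using s e by (simp add: mult_assoc)
qed

lemma idem_mult_eq:
  assumes s: "s \<in> carrier S" and e: "e \<in> idems S"
  shows "e \<cdot> s = s \<cdot> (s\<^sup>\<star> \<cdot> e \<cdot> s)"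
proof -
  have "s \<cdot> s\<^sup>\<star> \<cdot> e \<cdot> s = e \<cdot> (s \<cdot> s\<^sup>\<star>) \<cdot> s"
    using s e by (simp add: idems_commute)
  then show ?thesis
    using s e by (simp add: mult_assoc)
qed

section \<open>The natural partial order\<close>

lemma le_leftI:
  assumes s: "s \<in> carrier S" and e: "e \<in> idems S"
  shows "e \<cdot> s \<preceq> s"
  unfolding nat_le_def using idem_mult_eq[OF s e] conj_idem[of "s\<^sup>\<star>" e] s e
  by (metis inv_closed inv_inv)

lemma le_rightI: "e \<in> idems S \<Longrightarrow> s \<cdot> e \<preceq> s"
  unfolding nat_le_def by auto

lemma le_rightE:
  assumes "s \<preceq> t"
  obtains e where "e \<in> idems S" "s = t \<cdot> e"
  using assms unfolding nat_le_def by auto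

lemma le_leftE:
  assumes "s \<preceq> t" "t \<in> carrier S"
  obtains e where "e \<in> idems S" "s = e \<cdot> t"
proof -
  obtain e where e: "e \<in> idems S" "s = t \<cdot> e"
    using assms(1) by (rule le_rightE)
  show ?thesis
    by (rule that[of "t \<cdot> e \<cdot> t\<^sup>\<star>"]) (use e conj_idem mult_idem_eq assms in auto)
qed

lemma le_closed: "\<lbrakk>s \<preceq> t; t \<in> carrier S\<rbrakk> \<Longrightarrow> s \<in> carrier S"
  by (auto elim: le_rightE)

lemma le_refl [simp, intro]: "s \<in> carrier S \<Longrightarrow> s \<preceq> s"
  using le_rightI[of "s\<^sup>\<star> \<cdot> s" s] by simp

lemma le_trans [trans]:
  assumes "s \<preceq> t" "t \<preceq> u" "u \<in> carrier S"
  shows "s \<preceq> u"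
proof -
  obtain e f where "e \<in> idems S" "s = t \<cdot> e" "f \<in> idems S" "t = u \<cdot> f"
    using assms by (meson le_rightE)
  then show ?thesis
    using assms by (auto simp: mult_assoc intro: le_rightI)
qed

text \<open>The idempotent witnessing \<open>s \<preceq> t\<close> may be taken canonical: from
  \<open>s = te\<close> one gets \<open>s\<inverse>s = et\<inverse>te\<close>, and \<open>t\<close>
  absorbs \<open>t\<inverse>t\<close> after commuting.\<close>

lemma le_eq:
  assumes "s \<preceq> t" "t \<in> carrier S"
  shows "s = t \<cdot> (s\<^sup>\<star> \<cdot> s)"
proof -
  obtain e where e: "e \<in> idems S" "s = t \<cdot> e"
    using assms by (meson le_rightE)
  have "t \<cdot> (e \<cdot> (t\<^sup>\<star> \<cdot> t)) \<cdot> e = t \<cdot> (t\<^sup>\<star> \<cdot> t \<cdot> e) \<cdot> e"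
    using e assms by (simp add: idems_commute)
  then show ?thesis
    using e assms by (simp add: inv_mult mult_assoc)
qed

text \<open>The two canonical forms combine to \<open>s = s(t\<inverse>t)(s\<inverse>s)\<close>;
  commuting the idempotents reduces the right side to \<open>s(t\<inverse>t)\<close>, which is
  \<open>t\<close>.\<close>

lemma le_antisym:
  assumes "s \<preceq> t" "t \<preceq> s" "s \<in> carrier S" "t \<in> carrier S"
  shows "s = t"
proof -
  have "s = t \<cdot> (s\<^sup>\<star> \<cdot> s)" "t = s \<cdot> (t\<^sup>\<star> \<cdot> t)"
    using assms le_eq by auto
  then have "s = s \<cdot> (t\<^sup>\<star> \<cdot> t \<cdot> (s\<^sup>\<star> \<cdot> s))" "t = s \<cdot> (t\<^sup>\<star> \<cdot> t)"
    using assms by (metis inv_closed mult_assoc mult_closed)+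
  moreover have "t\<^sup>\<star> \<cdot> t \<cdot> (s\<^sup>\<star> \<cdot> s) = s\<^sup>\<star> \<cdot> s \<cdot> (t\<^sup>\<star> \<cdot> t)"
    using assms by (simp add: idems_commute)
  ultimately show ?thesis
    using assms by (metis inv_closed mult_assoc mult_closed mult_inv_mult)
qed

text \<open>With \<open>s = te\<close> and \<open>u = fv\<close>, both idempotents stand between
  \<open>t\<close> and \<open>v\<close>, and conjugation by \<open>v\<close> moves \<open>ef\<close>
  to the far right.\<close>

lemma mult_mono:
  assumes "s \<preceq> t" "u \<preceq> v" "t \<in> carrier S" "v \<in> carrier S"
  shows "s \<cdot> u \<preceq> t \<cdot> v"
proof -
  obtain e where e: "e \<in> idems S" "s = t \<cdot> e"
    using assms by (meson le_rightE)
  obtain f where f: "f \<in> idems S" "u = f \<cdot> v"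
    using assms by (meson le_leftE)
  have "s \<cdot> u = t \<cdot> (e \<cdot> f \<cdot> v)"
    using assms e f by (simp add: mult_assoc)
  also have "\<dots> = t \<cdot> v \<cdot> (v\<^sup>\<star> \<cdot> (e \<cdot> f) \<cdot> v)"
    using assms e f by (subst idem_mult_eq) (auto simp: mult_assoc)
  finally show ?thesis
    using assms e f conj_idem[of "v\<^sup>\<star>" "e \<cdot> f"] by (auto intro: le_rightI)
qed

lemma inv_mono:
  assumes "s \<preceq> t" "t \<in> carrier S"
  shows "s\<^sup>\<star> \<preceq> t\<^sup>\<star>"
proof -
  obtain e where "e \<in> idems S" "s = t \<cdot> e"
    using assms by (meson le_rightE)
  then show ?thesis
    using assms by (simp add: inv_mult le_leftI)
qed

lemma le_idem: "\<lbrakk>x \<preceq> e; e \<in> idems S\<rbrakk> \<Longrightarrow> x \<in> idems S"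
  by (auto elim: le_rightE)

lemma zero_le [simp]: "s \<in> carrier S \<Longrightarrow> \<zero> \<preceq> s"
  using le_rightI[of \<zero> s] by simp

lemma le_zero: "s \<preceq> \<zero> \<Longrightarrow> s = \<zero>"
  by (auto elim: le_rightE)

lemma join_unique: "\<lbrakk>is_join S A j; is_join S A k\<rbrakk> \<Longrightarrow> j = k"
  unfolding is_join_def by (meson le_antisym)

section \<open>Homomorphisms of inverse semigroups\<close>

lemma hom_inv:
  assumes T: "inverse_semigroup T" and \<theta>: "sg_hom S T \<theta>" and s: "s \<in> carrier S"
  shows "\<theta> (s\<^sup>\<star>) = (\<theta> s)\<^sup>\<star>\<^bsub>T\<^esub>"
proof -
  interpret T: inverse_semigroup T by (rule T)
  have "\<theta> (s \<cdot> s\<^sup>\<star> \<cdot> s) = \<theta> s" "\<theta> (s\<^sup>\<star> \<cdot> s \<cdot> s\<^sup>\<star>) = \<theta> (s\<^sup>\<star>)"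
    using s by (simp_all add: mult_assoc)
  then show ?thesis
    using \<theta> s unfolding sg_hom_def by (intro T.inv_unique[symmetric]) auto
qed

lemma hom_idem: "\<lbrakk>sg_hom S T \<theta>; e \<in> idems S\<rbrakk> \<Longrightarrow> \<theta> e \<in> idems T"
  unfolding sg_hom_def idems_def by (force simp: Pi_iff)

lemma hom_mono:
  assumes "sg_hom S T \<theta>" "s \<preceq> t" "t \<in> carrier S"
  shows "\<theta> s \<preceq>\<^bsub>T\<^esub> \<theta> t"
proof -
  obtain e where "e \<in> idems S" "s = t \<cdot> e"
    using assms by (meson le_rightE)
  then show ?thesis
    using assms hom_idem[of T \<theta> e] unfolding nat_le_def sg_hom_def by auto
qed

end


section \<open>Arrow closure\<close>

definition set_mult :: "'a zsemigroup \<Rightarrow> 'a set \<Rightarrow> 'a set \<Rightarrow> 'a set" (infixl "\<odot>\<index>" 70) where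
  "set_mult S X Y = {x \<cdot>\<^bsub>S\<^esub> y | x y. x \<in> X \<and> y \<in> Y}"

lemma set_multI [intro]: "\<lbrakk>x \<in> X; y \<in> Y\<rbrakk> \<Longrightarrow> x \<cdot>\<^bsub>S\<^esub> y \<in> X \<odot>\<^bsub>S\<^esub> Y"
  and set_multE [elim!]: "\<lbrakk>z \<in> X \<odot>\<^bsub>S\<^esub> Y; \<And>x y. \<lbrakk>x \<in> X; y \<in> Y; z = x \<cdot>\<^bsub>S\<^esub> y\<rbrakk> \<Longrightarrow> P\<rbrakk> \<Longrightarrow> P"
  by (auto simp: set_mult_def)

lemma set_mult_image: "X \<odot>\<^bsub>S\<^esub> Y = (\<lambda>(x, y). x \<cdot>\<^bsub>S\<^esub> y) ` (X \<times> Y)"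
  by (auto simp: set_mult_def)

lemma finite_set_mult: "\<lbrakk>finite X; finite Y\<rbrakk> \<Longrightarrow> finite (X \<odot>\<^bsub>S\<^esub> Y)"
  by (simp add: set_mult_image)

lemma (in inverse_semigroup) set_mult_closed:
  "\<lbrakk>X \<subseteq> carrier S; Y \<subseteq> carrier S\<rbrakk> \<Longrightarrow> X \<odot> Y \<subseteq> carrier S"
  by auto

lemma (in inverse_semigroup) set_mult_assoc:
  assumes "X \<subseteq> carrier S" "Y \<subseteq> carrier S" "Z \<subseteq> carrier S"
  shows "(X \<odot> Y) \<odot> Z = X \<odot> (Y \<odot> Z)"
proof (intro equalityI subsetI)
  fix w assume "w \<in> (X \<odot> Y) \<odot> Z"
  then obtain x y z where "x \<in> X" "y \<in> Y" "z \<in> Z" "w = x \<cdot> y \<cdot> z"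
    by auto
  then show "w \<in> X \<odot> (Y \<odot> Z)"
    using assms by (subst \<open>w = _\<close>, subst mult_assoc) auto
next
  fix w assume "w \<in> X \<odot> (Y \<odot> Z)"
  then obtain x y z where "x \<in> X" "y \<in> Y" "z \<in> Z" "w = x \<cdot> (y \<cdot> z)"
    by auto
  then show "w \<in> (X \<odot> Y) \<odot> Z"
    using assms by (subst \<open>w = _\<close>, subst mult_assoc[symmetric]) auto
qed

context inverse_meet_semigroup
begin

abbreviation cl :: "'a set \<Rightarrow> 'a set" where
  "cl \<equiv> arrow_closure S"

section \<open>Meets and the arrow relation\<close>

lemma is_meet_meet:
  assumes "s \<in> carrier S" "t \<in> carrier S"
  shows "is_meet S s t (meet S s t)"
proof -
  obtain m where m: "is_meet S s t m"
    using ex_meet assms by blast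
  moreover have "n = m" if "is_meet S s t n" for n
    using m that unfolding is_meet_def by (blast intro: le_antisym)
  ultimately show ?thesis
    unfolding meet_def by (rule theI)
qed

lemma
  assumes "s \<in> carrier S" "t \<in> carrier S"
  shows meet_closed [simp]: "meet S s t \<in> carrier S"
    and meet_le1: "meet S s t \<preceq> s"
    and meet_le2: "meet S s t \<preceq> t"
    and meet_greatest: "\<And>x. \<lbrakk>x \<in> carrier S; x \<preceq> s; x \<preceq> t\<rbrakk> \<Longrightarrow> x \<preceq> meet S s t"
  using is_meet_meet[OF assms] unfolding is_meet_def by auto

lemma meet_nonzero_iff:
  assumes "s \<in> carrier S" "t \<in> carrier S"
  shows "meet S s t \<noteq> \<zero> \<longleftrightarrow> (\<exists>y. y \<noteq> \<zero> \<and> y \<preceq> s \<and> y \<preceq> t)"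
  using assms meet_le1 meet_le2 meet_greatest le_zero le_closed by metis

text \<open>A meet is non-zero exactly when there is a common non-zero lower bound, so the arrow
  relation turns into a density condition on the order. In this form covering arguments proceed by
  repeatedly shrinking a non-zero element.\<close>

lemma arrow_iff:
  assumes "a \<in> carrier S" "A \<subseteq> carrier S"
  shows "arrow S a A \<longleftrightarrow> (\<forall>x. x \<preceq> a \<longrightarrow> x \<noteq> \<zero> \<longrightarrow> (\<exists>b \<in> A. \<exists>y. y \<noteq> \<zero> \<and> y \<preceq> x \<and> y \<preceq> b))"
proof -
  have "x \<in> down S a \<longleftrightarrow> x \<preceq> a" for x
    using assms le_closed by (auto simp: down_def)
  moreover have "meet S x b \<noteq> \<zero> \<longleftrightarrow> (\<exists>y. y \<noteq> \<zero> \<and> y \<preceq> x \<and> y \<preceq> b)"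
    if "x \<preceq> a" "b \<in> A" for x b
    using that assms le_closed by (intro meet_nonzero_iff) auto
  ultimately show ?thesis
    unfolding arrow_def by blast
qed

lemma arrow_mono: "\<lbrakk>arrow S a A; A \<subseteq> B\<rbrakk> \<Longrightarrow> arrow S a B"
  unfolding arrow_def by blast

text \<open>A non-zero \<open>x\<close> below \<open>a\<close> shrinks to some \<open>y\<close>
  below a member of \<open>A\<close>, and \<open>y\<close> then shrinks to some \<open>z\<close>
  below a member of \<open>B\<close>.\<close>

lemma arrow_trans:
  assumes "a \<in> carrier S" "A \<subseteq> carrier S" "B \<subseteq> carrier S"
    and aA: "arrow S a A" and AB: "\<And>b. b \<in> A \<Longrightarrow> arrow S b B"
  shows "arrow S a B"
  unfolding arrow_iff[OF assms(1,3)]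
proof (intro allI impI)
  fix x assume x: "x \<preceq> a" "x \<noteq> \<zero>"
  then obtain b y where y: "b \<in> A" "y \<noteq> \<zero>" "y \<preceq> x" "y \<preceq> b"
    using aA arrow_iff[OF assms(1,2)] by blast
  then obtain c z where "c \<in> B" "z \<noteq> \<zero>" "z \<preceq> y" "z \<preceq> c"
    using AB[OF \<open>b \<in> A\<close>] arrow_iff[of b B] assms by blast
  then show "\<exists>c \<in> B. \<exists>z. z \<noteq> \<zero> \<and> z \<preceq> x \<and> z \<preceq> c"
    using x y assms le_trans le_closed by blast
qed

text \<open>Writing a non-zero \<open>x \<le> ac\<close> as \<open>a(a\<inverse>x)\<close>, first shrink \<open>a\<inverse>x\<close> to a non-zero \<open>z\<close> below some \<open>c'\<close> in \<open>C\<close>,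
  then shrink the restriction \<open>azz\<inverse>\<close> of \<open>a\<close> to a non-zero \<open>v\<close> below some \<open>a'\<close> in \<open>A\<close>; now \<open>vz\<close> is below
  \<open>x\<close> and \<open>a'c'\<close>, and is non-zero because \<open>v = vzz\<inverse>\<close>.\<close>
lemma arrow_mult:
  assumes a: "a \<in> carrier S" and A: "A \<subseteq> carrier S" and aA: "arrow S a A"
    and c: "c \<in> carrier S" and C: "C \<subseteq> carrier S" and cC: "arrow S c C"
  shows "arrow S (a \<cdot> c) (A \<odot> C)"
  unfolding arrow_iff[OF mult_closed[OF a c] set_mult_closed[OF A C]]
proof (intro allI impI)
  fix x assume x: "x \<preceq> a \<cdot> c" "x \<noteq> \<zero>"
  then obtain e where e: "e \<in> idems S" "x = a \<cdot> c \<cdot> e"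
    by (meson le_rightE)
  have xc: "x \<in> carrier S"
    using e a c by simp
  have x_eq: "x = a \<cdot> (a\<^sup>\<star> \<cdot> x)"
    using e a c by (simp add: mult_assoc)
  have "a\<^sup>\<star> \<cdot> x \<preceq> a\<^sup>\<star> \<cdot> (a \<cdot> c)"
    using x a c by (intro mult_mono) auto
  also have "a\<^sup>\<star> \<cdot> (a \<cdot> c) = a\<^sup>\<star> \<cdot> a \<cdot> c"
    using a c by (simp add: mult_assoc)
  also have "\<dots> \<preceq> c"
    using a c by (intro le_leftI) auto
  finally have "a\<^sup>\<star> \<cdot> x \<preceq> c"
    using c by simp
  moreover have "a\<^sup>\<star> \<cdot> x \<noteq> \<zero>"
    using x x_eq a by auto
  ultimately obtain c' z where z: "c' \<in> C" "z \<noteq> \<zero>" "z \<preceq> a\<^sup>\<star> \<cdot> x" "z \<preceq> c'"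
    using cC arrow_iff[OF c C] by blast
  then have zc: "z \<in> carrier S"
    using C le_closed by auto
  have c': "c' \<in> carrier S"
    using C z by auto
  obtain f where f: "f \<in> idems S" "z = a\<^sup>\<star> \<cdot> x \<cdot> f"
    using z by (meson le_rightE)
  have z_eq: "z = a\<^sup>\<star> \<cdot> (a \<cdot> z)"
    using f a xc by (simp add: mult_assoc)
  have az: "a \<cdot> z \<preceq> x"
    using mult_mono[of a a z "a\<^sup>\<star> \<cdot> x"] z a xc x_eq by simp
  have "a \<cdot> (z \<cdot> z\<^sup>\<star>) \<noteq> \<zero>"
  proof
    assume "a \<cdot> (z \<cdot> z\<^sup>\<star>) = \<zero>"
    then have "a \<cdot> (z \<cdot> z\<^sup>\<star>) \<cdot> z = \<zero>"
      using zc by simp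
    then have "a \<cdot> z = \<zero>"
      using a zc by (simp add: mult_assoc)
    then show False
      using z_eq z a by simp
  qed
  moreover have "a \<cdot> (z \<cdot> z\<^sup>\<star>) \<preceq> a"
    using zc by (intro le_rightI) auto
  ultimately obtain a' v where v: "a' \<in> A" "v \<noteq> \<zero>" "v \<preceq> a \<cdot> (z \<cdot> z\<^sup>\<star>)" "v \<preceq> a'"
    using aA arrow_iff[OF a A] by blast
  have a': "a' \<in> carrier S"
    using A v by auto
  then have vc: "v \<in> carrier S"
    using v le_closed by auto
  obtain g where g: "g \<in> idems S" "v = a \<cdot> (z \<cdot> z\<^sup>\<star>) \<cdot> g"
    using v by (meson le_rightE)
  have "v = a \<cdot> (z \<cdot> z\<^sup>\<star> \<cdot> g)"
    using g a zc by (simp add: mult_assoc)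
  then have "v = a \<cdot> (g \<cdot> (z \<cdot> z\<^sup>\<star>))"
    using g zc by (simp add: idems_commute)
  then have v_eq: "v = v \<cdot> z \<cdot> z\<^sup>\<star>"
    using g zc a by (simp add: mult_assoc)
  have "v \<cdot> z \<noteq> \<zero>"
    using v_eq v zc by auto
  moreover have "v \<cdot> z \<preceq> x"
  proof -
    have "v \<cdot> z \<preceq> a \<cdot> (z \<cdot> z\<^sup>\<star>) \<cdot> z"
      using v a zc by (intro mult_mono) auto
    also have "\<dots> = a \<cdot> z"
      using a zc by (simp add: mult_assoc)
    also have "\<dots> \<preceq> x"
      by (rule az)
    finally show ?thesis
      using xc by simp
  qed
  moreover have "v \<cdot> z \<preceq> a' \<cdot> c'"
    using v z a' c' by (intro mult_mono) auto
  ultimately show "\<exists>b \<in> A \<odot> C. \<exists>y. y \<noteq> \<zero> \<and> y \<preceq> x \<and> y \<preceq> b"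
    using v z by blast
qed

text \<open>Inversion is an order-preserving involution that fixes zero, so it transports the
  shrinking of elements.\<close>

lemma arrow_inv:
  assumes a: "a \<in> carrier S" and A: "A \<subseteq> carrier S" and aA: "arrow S a A"
  shows "arrow S (a\<^sup>\<star>) (sg_inv S ` A)"
proof -
  have "\<exists>b \<in> sg_inv S ` A. \<exists>y. y \<noteq> \<zero> \<and> y \<preceq> x \<and> y \<preceq> b" if x: "x \<preceq> a\<^sup>\<star>" "x \<noteq> \<zero>" for x
  proof -
    have xc: "x \<in> carrier S"
      using x a le_closed by blast
    have inv_zero: "y = \<zero>" if "y\<^sup>\<star> = \<zero>" "y \<in> carrier S" for y
      using that inv_inv[of y] by simp
    have "x\<^sup>\<star> \<preceq> a"
      using inv_mono[OF x(1)] a by simp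
    moreover have "x\<^sup>\<star> \<noteq> \<zero>"
      using x xc inv_zero by blast
    ultimately obtain b y where y: "b \<in> A" "y \<noteq> \<zero>" "y \<preceq> x\<^sup>\<star>" "y \<preceq> b"
      using aA arrow_iff[OF a A] by blast
    have "y\<^sup>\<star> \<preceq> x"
      using inv_mono[OF y(3)] xc by simp
    moreover have "y\<^sup>\<star> \<preceq> b\<^sup>\<star>"
      using inv_mono[OF y(4)] y A by blast
    moreover have "y\<^sup>\<star> \<noteq> \<zero>"
      using inv_zero y xc le_closed by blast
    ultimately show ?thesis
      using y by blast
  qed
  then show ?thesis
    using a A by (subst arrow_iff) auto
qed

section \<open>The closure operator, with products and inverses of closures\<close>

lemma cl_closed: "cl X \<subseteq> carrier S"
  by (auto simp: arrow_closure_def)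

lemma cl_closedD: "s \<in> cl X \<Longrightarrow> s \<in> carrier S"
  by (auto simp: arrow_closure_def)

lemma clI: "\<lbrakk>s \<in> carrier S; finite F; F \<subseteq> X; arrow S s F\<rbrakk> \<Longrightarrow> s \<in> cl X"
  by (auto simp: arrow_closure_def)

lemma clE:
  assumes "s \<in> cl X"
  obtains F where "s \<in> carrier S" "finite F" "F \<subseteq> X" "arrow S s F"
  using assms by (auto simp: arrow_closure_def)

lemma cl_finite_iff: "finite A \<Longrightarrow> s \<in> cl A \<longleftrightarrow> s \<in> carrier S \<and> arrow S s A"
  by (meson arrow_mono clE clI order_refl)

lemma cl_mono: "X \<subseteq> Y \<Longrightarrow> cl X \<subseteq> cl Y"
  unfolding arrow_closure_def by blast

lemma arrow_le:
  assumes st: "s \<preceq> t" and t: "t \<in> carrier S"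
  shows "arrow S s {t}"
proof -
  have s: "s \<in> carrier S"
    by (rule le_closed[OF st t])
  have "x \<preceq> x \<and> x \<preceq> t" if "x \<preceq> s" for x
    using le_closed[OF that s] le_trans[OF that st t] by blast
  then show ?thesis
    using s t by (subst arrow_iff) blast+
qed

lemma le_cl: "\<lbrakk>s \<preceq> t; t \<in> X; X \<subseteq> carrier S\<rbrakk> \<Longrightarrow> s \<in> cl X"
  using arrow_le[of s t] le_closed by (intro clI[of s "{t}"]) auto

lemma subset_cl: "X \<subseteq> carrier S \<Longrightarrow> X \<subseteq> cl X"
  using le_cl by blast

text \<open>Nothing non-zero lies below zero, so already the empty set covers it. In particular a
  closure is never empty.\<close>

lemma zero_cl [simp]: "\<zero> \<in> cl X"
  by (rule clI[of _ "{}"]) (auto simp: arrow_def down_def dest: le_zero)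

text \<open>Transitivity of arrows: each of the finitely many elements \<open>b\<close> of
  \<open>F\<close> is replaced by its own finite set \<open>G b\<close>, and the union of these is
  again finite.\<close>

lemma cl_least:
  assumes "X \<subseteq> cl Y" "Y \<subseteq> carrier S"
  shows "cl X \<subseteq> cl Y"
proof
  fix s assume "s \<in> cl X"
  then obtain F where F: "s \<in> carrier S" "finite F" "F \<subseteq> X" "arrow S s F"
    by (rule clE)
  have "\<forall>b \<in> F. \<exists>G. finite G \<and> G \<subseteq> Y \<and> arrow S b G"
    using F assms by (meson clE subsetD)
  from bchoice[OF this] obtain G where G: "\<And>b. b \<in> F \<Longrightarrow> finite (G b) \<and> G b \<subseteq> Y \<and> arrow S b (G b)"
    by blast
  show "s \<in> cl Y"
  proof (rule clI[of s "\<Union> (G ` F)"])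
    show "arrow S s (\<Union> (G ` F))"
    proof (rule arrow_trans[of s F])
      show "arrow S b (\<Union> (G ` F))" if "b \<in> F" for b
        using G[OF that] that by (blast intro: arrow_mono[of b "G b"])
    qed (use F G assms cl_closed in blast)+
  qed (use F G in auto)
qed

lemma cl_cl [simp]: "X \<subseteq> carrier S \<Longrightarrow> cl (cl X) = cl X"
  by (meson cl_closed cl_least order_refl subset_antisym subset_cl)

lemma cl_down: "\<lbrakk>s \<preceq> t; t \<in> cl X; X \<subseteq> carrier S\<rbrakk> \<Longrightarrow> s \<in> cl X"
  using le_cl[of s t "cl X"] cl_closed by auto

lemma cl_mult:
  assumes "s \<in> cl X" "t \<in> cl Y" "X \<subseteq> carrier S" "Y \<subseteq> carrier S"
  shows "s \<cdot> t \<in> cl (X \<odot> Y)"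
proof -
  obtain F where F: "s \<in> carrier S" "finite F" "F \<subseteq> X" "arrow S s F"
    using assms(1) by (rule clE)
  obtain G where G: "t \<in> carrier S" "finite G" "G \<subseteq> Y" "arrow S t G"
    using assms(2) by (rule clE)
  show ?thesis
    by (rule clI[of _ "F \<odot> G"]) (use F G assms in \<open>auto intro!: arrow_mult finite_set_mult\<close>)
qed

text \<open>One inclusion rests on \<open>cl_mult\<close>, the other on monotonicity. Products in
  the completion can thus be computed on generators, which yields their associativity and their
  finite generation.\<close>

lemma cl_set_mult_cl:
  assumes "X \<subseteq> carrier S" "Y \<subseteq> carrier S"
  shows "cl (cl X \<odot> cl Y) = cl (X \<odot> Y)"
proof
  show "cl (cl X \<odot> cl Y) \<subseteq> cl (X \<odot> Y)"
    using assms cl_mult by (intro cl_least) auto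
  show "cl (X \<odot> Y) \<subseteq> cl (cl X \<odot> cl Y)"
    using subset_cl[OF assms(1)] subset_cl[OF assms(2)] by (intro cl_mono) blast
qed

lemma cl_inv:
  assumes "s \<in> cl X" "X \<subseteq> carrier S"
  shows "s\<^sup>\<star> \<in> cl (sg_inv S ` X)"
proof -
  obtain F where F: "s \<in> carrier S" "finite F" "F \<subseteq> X" "arrow S s F"
    using assms(1) by (rule clE)
  show ?thesis
    by (rule clI[of _ "sg_inv S ` F"]) (use F assms in \<open>auto intro!: arrow_inv\<close>)
qed

lemma inv_image_inv_image: "X \<subseteq> carrier S \<Longrightarrow> sg_inv S ` sg_inv S ` X = X"
  by (force simp: image_image)

lemma inv_image_closed: "X \<subseteq> carrier S \<Longrightarrow> sg_inv S ` X \<subseteq> carrier S"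
  by auto

lemma cl_inv_image:
  assumes "X \<subseteq> carrier S"
  shows "cl (sg_inv S ` X) = sg_inv S ` cl X"
proof
  show "sg_inv S ` cl X \<subseteq> cl (sg_inv S ` X)"
    using cl_inv assms by blast
  \<comment> \<open>The reverse inclusion is the first one applied to the set of inverses and then
    inverted.\<close>
  have "sg_inv S ` cl (sg_inv S ` X) \<subseteq> cl X"
    using cl_inv[of _ "sg_inv S ` X"] inv_image_inv_image[OF assms] inv_image_closed[OF assms] by auto
  then have "sg_inv S ` sg_inv S ` cl (sg_inv S ` X) \<subseteq> sg_inv S ` cl X"
    by blast
  then show "cl (sg_inv S ` X) \<subseteq> sg_inv S ` cl X"
    using inv_image_inv_image[OF cl_closed] by simp
qed

subsection \<open>Compatibility up to covers\<close>

abbreviation Q :: "'a set" where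
  "Q \<equiv> cl (idems S)"

lemma idems_subset: "idems S \<subseteq> carrier S"
  by auto

lemma idem_up_to_cover_iff: "s \<in> carrier S \<Longrightarrow> idem_up_to_cover S s \<longleftrightarrow> s \<in> Q"
  unfolding idem_up_to_cover_def arrow_closure_def by auto

text \<open>The idempotents that witness membership in \<open>Q\<close> need not lie below
  \<open>u\<close>. But an idempotent \<open>y\<close> below \<open>u\<close> equals
  \<open>y\<inverse>y\<close> and so is also below \<open>u\<inverse>u\<close>; hence a single meet
  can replace the whole family.\<close>

lemma QE:
  assumes "u \<in> Q"
  obtains m where "m \<in> idems S" "m \<preceq> u" "arrow S u {m}"
proof -
  obtain F where F: "u \<in> carrier S" "finite F" "F \<subseteq> idems S" "arrow S u F"
    using assms by (rule clE)
  \<comment> \<open>the largest idempotent below \<open>u\<close>\<close>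
  define m where "m = meet S u (u\<^sup>\<star> \<cdot> u)"
  have m: "m \<in> carrier S" "m \<preceq> u" "m \<preceq> u\<^sup>\<star> \<cdot> u"
    using F(1) meet_le1[of u "u\<^sup>\<star> \<cdot> u"] meet_le2[of u "u\<^sup>\<star> \<cdot> u"] by (simp_all add: m_def)
  have "\<exists>y. y \<noteq> \<zero> \<and> y \<preceq> x \<and> y \<preceq> m" if x: "x \<preceq> u" "x \<noteq> \<zero>" for x
  proof -
    obtain b y where y: "b \<in> F" "y \<noteq> \<zero>" "y \<preceq> x" "y \<preceq> b"
      using F(4) x arrow_iff[of u F] F(1,3) idems_subset by blast
    then have "y \<in> idems S"
      using F(3) le_idem by blast
    have "y \<preceq> u"
      using le_trans[OF y(3) x(1) F(1)] .
    then have "y\<^sup>\<star> \<cdot> y \<preceq> u\<^sup>\<star> \<cdot> u"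
      using F(1) by (intro mult_mono inv_mono) auto
    then have "y \<preceq> m"
      unfolding m_def using \<open>y \<in> idems S\<close> \<open>y \<preceq> u\<close> F(1) by (intro meet_greatest) auto
    then show ?thesis
      using y by blast
  qed
  then have "arrow S u {m}"
    using F(1) m(1) by (subst arrow_iff) auto
  moreover have "m \<in> idems S"
    by (rule le_idem[OF m(3)]) (use F(1) in auto)
  ultimately show ?thesis
    using that m(2) by blast
qed

text \<open>Multiplying by an idempotent moves an element down, and closed sets are closed
  downwards. Since products pass to closures, the idempotent may be replaced by an element of
  \<open>Q\<close>.\<close>

lemma Q_mult_left:
  assumes "u \<in> Q" "cl X = X" "t \<in> X"
  shows "u \<cdot> t \<in> X"
proof -
  have X: "X \<subseteq> carrier S"
    using cl_closed[of X] assms(2) by simp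
  have "idems S \<odot> X \<subseteq> cl X"
    using X by (auto intro: le_cl[OF le_leftI])
  then have "cl (idems S \<odot> X) \<subseteq> X"
    using cl_least[OF _ X] assms(2) by simp
  then show ?thesis
    using cl_mult[of u "idems S" t X] assms X idems_subset by auto
qed

lemma Q_mult_right:
  assumes "u \<in> Q" "cl X = X" "t \<in> X"
  shows "t \<cdot> u \<in> X"
proof -
  have X: "X \<subseteq> carrier S"
    using cl_closed[of X] assms(2) by simp
  have "X \<odot> idems S \<subseteq> cl X"
    using X by (auto intro: le_cl[OF le_rightI])
  then have "cl (X \<odot> idems S) \<subseteq> X"
    using cl_least[OF _ X] assms(2) by simp
  then show ?thesis
    using cl_mult[of t X u "idems S"] assms X idems_subset by auto
qed

lemma Q_mult: "\<lbrakk>u \<in> Q; v \<in> Q\<rbrakk> \<Longrightarrow> u \<cdot> v \<in> Q"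
  using Q_mult_left[of u Q v] idems_subset by simp

lemma cl_subset_Q: "X \<subseteq> Q \<Longrightarrow> cl X \<subseteq> Q"
  using cl_least idems_subset by blast

lemma compatible_iff:
  "compatible_up_to_cover S X \<longleftrightarrow>
     X \<subseteq> carrier S \<and> (\<forall>s \<in> X. \<forall>t \<in> X. s\<^sup>\<star> \<cdot> t \<in> Q \<and> s \<cdot> t\<^sup>\<star> \<in> Q)"
  unfolding compatible_up_to_cover_def
  by (intro conj_cong refl ball_cong) (auto simp: idem_up_to_cover_iff subset_iff)

lemma compatible_closed: "compatible_up_to_cover S X \<Longrightarrow> X \<subseteq> carrier S"
  by (simp add: compatible_iff)

lemma compatible_mono: "\<lbrakk>compatible_up_to_cover S X; Y \<subseteq> X\<rbrakk> \<Longrightarrow> compatible_up_to_cover S Y"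
  unfolding compatible_iff by blast

lemma compatible_cl:
  assumes "compatible_up_to_cover S X"
  shows "compatible_up_to_cover S (cl X)"
  unfolding compatible_iff
proof (intro conjI ballI cl_closed)
  have X: "X \<subseteq> carrier S"
    using assms by (rule compatible_closed)
  fix s t assume s: "s \<in> cl X" and t: "t \<in> cl X"
  have "sg_inv S ` X \<odot> X \<subseteq> Q" "X \<odot> sg_inv S ` X \<subseteq> Q"
    using assms unfolding compatible_iff by auto
  then have "cl (sg_inv S ` X \<odot> X) \<subseteq> Q" "cl (X \<odot> sg_inv S ` X) \<subseteq> Q"
    by (auto dest!: cl_subset_Q)
  moreover have "s\<^sup>\<star> \<cdot> t \<in> cl (sg_inv S ` X \<odot> X)"
    using cl_inv[OF s X] t X by (intro cl_mult) auto
  moreover have "s \<cdot> t\<^sup>\<star> \<in> cl (X \<odot> sg_inv S ` X)"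
    using cl_inv[OF t X] s X by (intro cl_mult) auto
  ultimately show "s\<^sup>\<star> \<cdot> t \<in> Q" "s \<cdot> t\<^sup>\<star> \<in> Q"
    by auto
qed

lemma compatible_inv_image:
  "compatible_up_to_cover S X \<Longrightarrow> compatible_up_to_cover S (sg_inv S ` X)"
  unfolding compatible_iff by auto

lemma compatible_singleton: "s \<in> carrier S \<Longrightarrow> compatible_up_to_cover S {s}"
  unfolding compatible_iff using subset_cl[OF idems_subset] by auto

text \<open>In \<open>(xy)\<inverse>(x'y') = y\<inverse>(x\<inverse>x')y'\<close> the middle factor
  lies in \<open>Q\<close> and is absorbed by \<open>cl Y\<close>, so compatibility of
  \<open>cl Y\<close> applies. For the other product, \<open>cl X\<close> absorbs
  \<open>yy'\<inverse>\<close>.\<close>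

lemma compatible_set_mult:
  assumes X: "compatible_up_to_cover S X" and Y: "compatible_up_to_cover S Y"
  shows "compatible_up_to_cover S (X \<odot> Y)"
  unfolding compatible_iff
proof (intro conjI ballI)
  have Xc: "X \<subseteq> carrier S" and Yc: "Y \<subseteq> carrier S"
    using X Y compatible_closed by auto
  show "X \<odot> Y \<subseteq> carrier S"
    by (rule set_mult_closed[OF Xc Yc])
  fix s t assume "s \<in> X \<odot> Y" "t \<in> X \<odot> Y"
  then obtain x y x' y' where s: "x \<in> X" "y \<in> Y" "s = x \<cdot> y" and t: "x' \<in> X" "y' \<in> Y" "t = x' \<cdot> y'"
    by auto
  then have c: "x \<in> carrier S" "y \<in> carrier S" "x' \<in> carrier S" "y' \<in> carrier S"
    using Xc Yc by auto
  have "y \<in> cl Y" "y' \<in> cl Y" "x \<in> cl X" "x' \<in> cl X"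
    using subset_cl[OF Xc] subset_cl[OF Yc] s t by auto
  moreover have "x\<^sup>\<star> \<cdot> x' \<in> Q" "y \<cdot> y'\<^sup>\<star> \<in> Q"
    using X Y s t unfolding compatible_iff by auto
  ultimately have "x\<^sup>\<star> \<cdot> x' \<cdot> y' \<in> cl Y" "x \<cdot> (y \<cdot> y'\<^sup>\<star>) \<in> cl X"
    using Q_mult_left[of "x\<^sup>\<star> \<cdot> x'" "cl Y" y'] Q_mult_right[of "y \<cdot> y'\<^sup>\<star>" "cl X" x] Xc Yc by auto
  then have "y\<^sup>\<star> \<cdot> (x\<^sup>\<star> \<cdot> x' \<cdot> y') \<in> Q" "x \<cdot> (y \<cdot> y'\<^sup>\<star>) \<cdot> x'\<^sup>\<star> \<in> Q"
    using compatible_cl[OF X] compatible_cl[OF Y] \<open>y \<in> cl Y\<close> \<open>x' \<in> cl X\<close>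
    unfolding compatible_iff by blast+
  then show "s\<^sup>\<star> \<cdot> t \<in> Q" "s \<cdot> t\<^sup>\<star> \<in> Q"
    using s t c by (simp_all add: inv_mult mult_assoc)
qed

subsection \<open>The completion\<close>

abbreviation D :: "'a set zsemigroup" where
  "D \<equiv> distr_completion S"

section \<open>Elements of the completion and their products\<close>

lemma D_mem_iff: "X \<in> carrier D \<longleftrightarrow> (\<exists>A. finite A \<and> compatible_up_to_cover S A \<and> X = cl A)"
  by (auto simp: distr_completion_def)

lemma D_memI: "\<lbrakk>finite A; compatible_up_to_cover S A\<rbrakk> \<Longrightarrow> cl A \<in> carrier D"
  by (auto simp: D_mem_iff)

lemma D_memE:
  assumes "X \<in> carrier D"
  obtains A where "finite A" "compatible_up_to_cover S A" "A \<subseteq> carrier S" "X = cl A"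
  using assms compatible_closed unfolding D_mem_iff by blast

lemma D_cl: "X \<in> carrier D \<Longrightarrow> cl X = X"
  by (auto elim: D_memE)

lemma D_subset: "X \<in> carrier D \<Longrightarrow> X \<subseteq> carrier S"
  using cl_closed by (auto simp: D_mem_iff)

lemma D_compatible: "X \<in> carrier D \<Longrightarrow> compatible_up_to_cover S X"
  by (auto simp: D_mem_iff compatible_cl)

lemma D_cl_least: "\<lbrakk>X \<subseteq> Y; Y \<in> carrier D\<rbrakk> \<Longrightarrow> cl X \<subseteq> Y"
  using cl_mono[of X Y] by (simp add: D_cl)

lemma D_mult: "X \<cdot>\<^bsub>D\<^esub> Y = cl (X \<odot> Y)"
  by (simp add: distr_completion_def set_mult_def)

lemma D_mult_mem: "\<lbrakk>x \<in> X; y \<in> Y; X \<in> carrier D; Y \<in> carrier D\<rbrakk> \<Longrightarrow> x \<cdot> y \<in> X \<cdot>\<^bsub>D\<^esub> Y"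
  unfolding D_mult using subset_cl[OF set_mult_closed[of X Y]] D_subset by blast

lemma D_zero: "\<zero>\<^bsub>D\<^esub> = {\<zero>}"
  by (simp add: distr_completion_def)

text \<open>An element covered by the empty set has nothing non-zero below it, itself included. This
  exhibits the zero of the completion as generated by a finite set, the empty one.\<close>

lemma cl_empty: "cl {} = {\<zero>}"
proof -
  have "s = \<zero>" if "s \<in> carrier S" "arrow S s {}" for s
    using that arrow_iff[of s "{}"] by auto
  then have "cl {} \<subseteq> {\<zero>}"
    by (auto simp: cl_finite_iff)
  then show ?thesis
    using zero_cl by blast
qed

lemma D_mult_closed:
  assumes "X \<in> carrier D" "Y \<in> carrier D"
  shows "X \<cdot>\<^bsub>D\<^esub> Y \<in> carrier D"
proof -
  obtain A where A: "finite A" "compatible_up_to_cover S A" "A \<subseteq> carrier S" "X = cl A"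
    using assms(1) by (rule D_memE)
  obtain B where B: "finite B" "compatible_up_to_cover S B" "B \<subseteq> carrier S" "Y = cl B"
    using assms(2) by (rule D_memE)
  have "X \<cdot>\<^bsub>D\<^esub> Y = cl (A \<odot> B)"
    using A B by (simp add: D_mult cl_set_mult_cl)
  then show ?thesis
    using A B by (auto intro!: D_memI finite_set_mult compatible_set_mult)
qed

lemma D_mult_left_cl:
  assumes "X \<in> carrier D" "Y \<subseteq> carrier S"
  shows "X \<cdot>\<^bsub>D\<^esub> cl Y = cl (X \<odot> Y)"
  using cl_set_mult_cl[of X Y] assms D_cl[of X] D_subset[of X] by (simp add: D_mult)

lemma D_mult_right_cl:
  assumes "X \<in> carrier D" "Y \<subseteq> carrier S"
  shows "cl Y \<cdot>\<^bsub>D\<^esub> X = cl (Y \<odot> X)"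
  using cl_set_mult_cl[of Y X] assms D_cl[of X] D_subset[of X] by (simp add: D_mult)

lemma D_mult_assoc:
  assumes "X \<in> carrier D" "Y \<in> carrier D" "Z \<in> carrier D"
  shows "X \<cdot>\<^bsub>D\<^esub> Y \<cdot>\<^bsub>D\<^esub> Z = X \<cdot>\<^bsub>D\<^esub> (Y \<cdot>\<^bsub>D\<^esub> Z)"
proof -
  have "X \<cdot>\<^bsub>D\<^esub> Y \<cdot>\<^bsub>D\<^esub> Z = cl (X \<odot> Y \<odot> Z)"
    using D_mult_right_cl[of Z "X \<odot> Y"] assms set_mult_closed D_subset by (simp add: D_mult)
  moreover have "X \<cdot>\<^bsub>D\<^esub> (Y \<cdot>\<^bsub>D\<^esub> Z) = cl (X \<odot> (Y \<odot> Z))"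
    using D_mult_left_cl[of X "Y \<odot> Z"] assms set_mult_closed D_subset by (simp add: D_mult)
  ultimately show ?thesis
    using assms D_subset by (simp add: set_mult_assoc)
qed

section \<open>Regularity and idempotents of the completion\<close>

lemma D_inv_closed:
  assumes "X \<in> carrier D"
  shows "sg_inv S ` X \<in> carrier D"
proof -
  obtain A where "finite A" "compatible_up_to_cover S A" "A \<subseteq> carrier S" "X = cl A"
    using assms by (rule D_memE)
  then show ?thesis
    using D_memI[of "sg_inv S ` A"] by (simp add: cl_inv_image compatible_inv_image)
qed

text \<open>Compatibility places \<open>xy\<inverse>\<close> in \<open>Q\<close>, so
  \<open>xy\<inverse>z\<close> stays in the closed set \<open>X\<close>; conversely
  \<open>x = xx\<inverse>x\<close>.\<close>

lemma D_regular:
  assumes X: "X \<in> carrier D"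
  shows "X \<cdot>\<^bsub>D\<^esub> sg_inv S ` X \<cdot>\<^bsub>D\<^esub> X = X"
proof
  have c: "X \<subseteq> carrier S"
    using X by (rule D_subset)
  have eq: "X \<cdot>\<^bsub>D\<^esub> sg_inv S ` X \<cdot>\<^bsub>D\<^esub> X = cl (X \<odot> sg_inv S ` X \<odot> X)"
    using D_mult_right_cl[of X "X \<odot> sg_inv S ` X"] X c set_mult_closed inv_image_closed
    by (simp add: D_mult)
  have "x \<cdot> y\<^sup>\<star> \<cdot> z \<in> X" if "x \<in> X" "y \<in> X" "z \<in> X" for x y z
    using that D_compatible[OF X] D_cl[OF X] c unfolding compatible_iff
    by (intro Q_mult_left[of "x \<cdot> y\<^sup>\<star>"]) auto
  then show "X \<cdot>\<^bsub>D\<^esub> sg_inv S ` X \<cdot>\<^bsub>D\<^esub> X \<subseteq> X"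
    unfolding eq by (intro D_cl_least X) auto
  show "X \<subseteq> X \<cdot>\<^bsub>D\<^esub> sg_inv S ` X \<cdot>\<^bsub>D\<^esub> X"
  proof
    fix x assume "x \<in> X"
    then have "x \<cdot> x\<^sup>\<star> \<cdot> x \<in> X \<cdot>\<^bsub>D\<^esub> sg_inv S ` X \<cdot>\<^bsub>D\<^esub> X"
      using X by (intro D_mult_mem D_mult_closed D_inv_closed) auto
    then show "x \<in> X \<cdot>\<^bsub>D\<^esub> sg_inv S ` X \<cdot>\<^bsub>D\<^esub> X"
      using \<open>x \<in> X\<close> c by (auto simp: mult_assoc subset_iff)
  qed
qed

lemma D_mult_subset_Q:
  assumes X: "X \<in> carrier D" "X \<subseteq> Q" and Y: "Y \<in> carrier D" "Y \<subseteq> Q"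
  shows "X \<cdot>\<^bsub>D\<^esub> Y = X \<inter> Y"
proof
  have "X \<odot> Y \<subseteq> X" "X \<odot> Y \<subseteq> Y"
    using X Y Q_mult_left[of _ Y] Q_mult_right[of _ X] D_cl by auto
  then show "X \<cdot>\<^bsub>D\<^esub> Y \<subseteq> X \<inter> Y"
    using X Y D_cl_least by (simp add: D_mult)
  show "X \<inter> Y \<subseteq> X \<cdot>\<^bsub>D\<^esub> Y"
  proof
    fix z assume z: "z \<in> X \<inter> Y"
    \<comment> \<open>A single idempotent \<open>m\<close> covers \<open>z\<close>. Being below
      \<open>z\<close> it lies in both sets, and as \<open>m = mm\<close> it lies in their
      elementwise product, whose closure then contains \<open>z\<close>.\<close>
    then obtain m where m: "m \<in> idems S" "m \<preceq> z" "arrow S z {m}"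
      using X by (meson IntD1 QE subsetD)
    then have "m \<in> X" "m \<in> Y"
      using z X Y cl_down[OF m(2)] D_cl D_subset by blast+
    then have "m \<cdot> m \<in> X \<odot> Y"
      by blast
    then have "m \<in> X \<odot> Y"
      using m by simp
    then show "z \<in> X \<cdot>\<^bsub>D\<^esub> Y"
      unfolding D_mult using z X D_subset m by (intro clI[of z "{m}"]) auto
  qed
qed

text \<open>With \<open>X\<close> also \<open>X\<inverse>\<close> is idempotent, so \<open>X = XX\<inverse>X = (XX\<inverse>)(X\<inverse>X)\<close> is a product of two subsets of \<open>Q\<close>.\<close>
lemma D_idem_subset_Q:
  assumes X: "X \<in> carrier D" and idem: "X \<cdot>\<^bsub>D\<^esub> X = X"
  shows "X \<subseteq> Q"
proof
  have c: "X \<subseteq> carrier S"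
    using X by (rule D_subset)
  fix s assume s: "s \<in> X"
  then have sc: "s \<in> carrier S"
    using c by blast
  have "s \<in> cl (X \<odot> X)"
    using s idem by (simp add: D_mult)
  then have "s\<^sup>\<star> \<in> cl (sg_inv S ` (X \<odot> X))"
    using set_mult_closed[OF c c] by (rule cl_inv)
  moreover have "s \<in> cl {s}"
    using subset_cl sc by auto
  moreover have XX: "sg_inv S ` (X \<odot> X) \<subseteq> carrier S"
    using c by auto
  ultimately have "s \<cdot> (s\<^sup>\<star> \<cdot> s) \<in> cl ({s} \<odot> (sg_inv S ` (X \<odot> X) \<odot> {s}))"
    using sc by (intro cl_mult set_mult_closed) auto
  moreover have "{s} \<odot> (sg_inv S ` (X \<odot> X) \<odot> {s}) \<subseteq> Q"
  proof
    fix w assume "w \<in> {s} \<odot> (sg_inv S ` (X \<odot> X) \<odot> {s})"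
    then obtain a b where ab: "a \<in> X" "b \<in> X" "w = s \<cdot> ((a \<cdot> b)\<^sup>\<star> \<cdot> s)"
      by auto
    then have "a \<in> carrier S" "b \<in> carrier S"
      using c by auto
    then have "w = (s \<cdot> b\<^sup>\<star>) \<cdot> (a\<^sup>\<star> \<cdot> s)"
      using ab sc by (simp add: inv_mult mult_assoc)
    then show "w \<in> Q"
      using ab s D_compatible[OF X] Q_mult unfolding compatible_iff by auto
  qed
  ultimately show "s \<in> Q"
    using cl_subset_Q sc by auto
qed

lemma D_idem_iff: "X \<in> idems D \<longleftrightarrow> X \<in> carrier D \<and> X \<subseteq> Q"
proof -
  have "X \<cdot>\<^bsub>D\<^esub> X = X" if "X \<in> carrier D" "X \<subseteq> Q"
    using D_mult_subset_Q[OF that that] by simp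
  then show ?thesis
    using D_idem_subset_Q unfolding idems_def by blast
qed

lemma D_inverse_semigroup: "inverse_semigroup D"
proof (rule inverse_semigroupI)
  show "\<zero>\<^bsub>D\<^esub> \<in> carrier D"
    using D_memI[of "{}"] by (simp add: D_zero cl_empty compatible_iff)
  fix X assume X: "X \<in> carrier D"
  \<comment> \<open>An empty \<open>X\<close> would make the products with \<open>{\<zero>}\<close>
    empty instead of \<open>{\<zero>}\<close>.\<close>
  have "X \<noteq> {}"
    using X zero_cl by (metis D_mem_iff empty_iff)
  then have "{\<zero>} \<odot> X = {\<zero>}" "X \<odot> {\<zero>} = {\<zero>}"
    using D_subset[OF X] by (force simp: set_mult_def)+
  moreover have "cl {\<zero>} = {\<zero>}"
    using cl_cl[of "{}"] by (simp add: cl_empty)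
  ultimately show "\<zero>\<^bsub>D\<^esub> \<cdot>\<^bsub>D\<^esub> X = \<zero>\<^bsub>D\<^esub>" "X \<cdot>\<^bsub>D\<^esub> \<zero>\<^bsub>D\<^esub> = \<zero>\<^bsub>D\<^esub>"
    by (simp_all add: D_mult D_zero)
  show "\<exists>Y \<in> carrier D. X \<cdot>\<^bsub>D\<^esub> Y \<cdot>\<^bsub>D\<^esub> X = X \<and> Y \<cdot>\<^bsub>D\<^esub> X \<cdot>\<^bsub>D\<^esub> Y = Y"
    using D_regular[OF X] D_regular[OF D_inv_closed[OF X]] D_inv_closed[OF X] D_subset[OF X]
    by (auto simp: inv_image_inv_image)
qed (use D_mult_closed D_mult_assoc D_idem_iff D_mult_subset_Q in auto)

section \<open>Inverses, order and meets in the completion\<close>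

lemma D_inv:
  assumes X: "X \<in> carrier D"
  shows "X\<^sup>\<star>\<^bsub>D\<^esub> = sg_inv S ` X"
proof -
  interpret D: inverse_semigroup D by (rule D_inverse_semigroup)
  show ?thesis
    using D_regular[OF X] D_regular[OF D_inv_closed[OF X]] D_inv_closed[OF X] D_subset[OF X] X
    by (intro D.inv_unique) (simp_all add: inv_image_inv_image)
qed

lemma D_le_iff:
  assumes X: "X \<in> carrier D" and Y: "Y \<in> carrier D"
  shows "X \<preceq>\<^bsub>D\<^esub> Y \<longleftrightarrow> X \<subseteq> Y"
proof
  assume "X \<preceq>\<^bsub>D\<^esub> Y"
  then obtain E where "E \<in> carrier D" "E \<subseteq> Q" "X = Y \<cdot>\<^bsub>D\<^esub> E"
    unfolding nat_le_def by (meson D_idem_iff)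
  moreover have "Y \<odot> E \<subseteq> Y"
    using \<open>E \<subseteq> Q\<close> Q_mult_right[of _ Y] Y D_cl by auto
  ultimately show "X \<subseteq> Y"
    using Y D_cl_least by (simp add: D_mult)
next
  assume XY: "X \<subseteq> Y"
  interpret D: inverse_semigroup D by (rule D_inverse_semigroup)
  let ?E = "sg_inv S ` X \<cdot>\<^bsub>D\<^esub> X"
  have c: "X \<subseteq> carrier S" "Y \<subseteq> carrier S"
    using X Y by (auto dest: D_subset)
  have E: "?E \<in> idems D"
    using D.inv_mult_idem[OF X] by (simp add: D_inv X)
  have "X = Y \<cdot>\<^bsub>D\<^esub> ?E"
  proof
    have "X = X \<cdot>\<^bsub>D\<^esub> ?E"
      using D_regular[OF X] X D_inv_closed[OF X] by (simp add: D_mult_assoc)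
    also have "\<dots> \<subseteq> Y \<cdot>\<^bsub>D\<^esub> ?E"
      unfolding D_mult[of X] D_mult[of Y] using XY by (intro cl_mono) auto
    finally show "X \<subseteq> Y \<cdot>\<^bsub>D\<^esub> ?E" .
    \<comment> \<open>Since \<open>x\<close> lies in \<open>Y\<close> as well, compatibility of
      \<open>Y\<close> puts \<open>yx\<inverse>\<close> into \<open>Q\<close>, and the closed set
      \<open>X\<close> absorbs it.\<close>
    have "y \<cdot> (x\<^sup>\<star> \<cdot> z) \<in> X" if "y \<in> Y" "x \<in> X" "z \<in> X" for x y z
    proof -
      have "y \<cdot> x\<^sup>\<star> \<cdot> z \<in> X"
        using that XY X D_compatible[OF Y] D_cl unfolding compatible_iff
        by (intro Q_mult_left[of "y \<cdot> x\<^sup>\<star>"]) auto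
      moreover have "y \<cdot> x\<^sup>\<star> \<cdot> z = y \<cdot> (x\<^sup>\<star> \<cdot> z)"
        using that c by (intro mult_assoc) auto
      ultimately show ?thesis
        by simp
    qed
    then have "cl (Y \<odot> (sg_inv S ` X \<odot> X)) \<subseteq> X"
      by (intro D_cl_least X) auto
    then show "Y \<cdot>\<^bsub>D\<^esub> ?E \<subseteq> X"
      using D_mult_left_cl[OF Y, of "sg_inv S ` X \<odot> X"] c
      by (simp add: D_mult[of "sg_inv S ` X"] set_mult_closed inv_image_closed)
  qed
  then show "X \<preceq>\<^bsub>D\<^esub> Y"
    using E unfolding nat_le_def by blast
qed

text \<open>Pairwise meets of generators generate the intersection: a non-zero element below
  \<open>s\<close> shrinks below some \<open>a\<close> in \<open>A\<close>, then below some
  \<open>b\<close> in \<open>B\<close>, hence below their meet. Compatibility is inherited from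
  \<open>X\<close>.\<close>

lemma D_inter_closed:
  assumes X: "X \<in> carrier D" and Y: "Y \<in> carrier D"
  shows "X \<inter> Y \<in> carrier D"
proof -
  obtain A where A: "finite A" "compatible_up_to_cover S A" "A \<subseteq> carrier S" "X = cl A"
    using X by (rule D_memE)
  obtain B where B: "finite B" "compatible_up_to_cover S B" "B \<subseteq> carrier S" "Y = cl B"
    using Y by (rule D_memE)
  define M where "M = (\<lambda>(a, b). meet S a b) ` (A \<times> B)"
  have M: "finite M" "M \<subseteq> carrier S"
    using A B by (auto simp: M_def intro!: meet_closed)
  have "M \<subseteq> X \<inter> Y"
    using A B by (auto simp: M_def intro: le_cl[OF meet_le1] le_cl[OF meet_le2])
  have "s \<in> cl M" if s: "s \<in> X \<inter> Y" for s
  proof -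
    have sc: "s \<in> carrier S"
      using s X D_subset by blast
    have "\<exists>m \<in> M. \<exists>y. y \<noteq> \<zero> \<and> y \<preceq> x \<and> y \<preceq> m" if x: "x \<preceq> s" "x \<noteq> \<zero>" for x
    proof -
      have xc: "x \<in> carrier S"
        using x sc le_closed by blast
      obtain a y where y: "a \<in> A" "y \<noteq> \<zero>" "y \<preceq> x" "y \<preceq> a"
        using s x A arrow_iff[OF sc A(3)] by (auto simp: cl_finite_iff)
      have "y \<preceq> s"
        using le_trans[OF y(3) x(1) sc] .
      then obtain b z where z: "b \<in> B" "z \<noteq> \<zero>" "z \<preceq> y" "z \<preceq> b"
        using s y B arrow_iff[OF sc B(3)] by (auto simp: cl_finite_iff)
      have ab: "a \<in> carrier S" "b \<in> carrier S"
        using A B y z by auto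
      have "z \<preceq> a" "z \<preceq> x"
        using le_trans[OF z(3) y(4) ab(1)] le_trans[OF z(3) y(3) xc] by auto
      then have "z \<preceq> meet S a b"
        using z ab xc by (intro meet_greatest) (auto intro: le_closed)
      then show ?thesis
        using y z \<open>z \<preceq> x\<close> by (force simp: M_def)
    qed
    then have "arrow S s M"
      using sc M by (subst arrow_iff) auto
    then show ?thesis
      using sc M by (simp add: cl_finite_iff)
  qed
  moreover have "cl M \<subseteq> X \<inter> Y"
    using \<open>M \<subseteq> X \<inter> Y\<close> D_cl_least[OF _ X] D_cl_least[OF _ Y] by auto
  ultimately have "X \<inter> Y = cl M"
    by blast
  moreover have "compatible_up_to_cover S M"
    using \<open>M \<subseteq> X \<inter> Y\<close> by (intro compatible_mono[OF D_compatible[OF X]]) auto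
  ultimately show ?thesis
    using M D_memI by simp
qed

lemma D_inverse_meet_semigroup: "inverse_meet_semigroup D"
proof -
  interpret D: inverse_semigroup D by (rule D_inverse_semigroup)
  show ?thesis
  proof
    fix X Y assume "X \<in> carrier D" "Y \<in> carrier D"
    then have "is_meet D X Y (X \<inter> Y)"
      unfolding is_meet_def by (simp add: D_le_iff D_inter_closed)
    then show "\<exists>M. is_meet D X Y M" ..
  qed
qed

section \<open>Joins and distributivity in the completion\<close>

lemma D_join_closed:
  assumes fin: "finite \<A>" and comp: "compatible D \<A>"
  shows "cl (\<Union>\<A>) \<in> carrier D"
proof -
  have \<A>: "X \<in> carrier D" if "X \<in> \<A>" for X
    using that comp unfolding compatible_def by blast
  \<comment> \<open>The members of \<open>\<A>\<close> may be infinite; generators are chosen so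
    that a finite set generates the join.\<close>
  have "\<forall>X \<in> \<A>. \<exists>A. finite A \<and> A \<subseteq> carrier S \<and> X = cl A"
    using \<A> by (meson D_memE)
  from bchoice[OF this] obtain A
    where "\<forall>X \<in> \<A>. finite (A X) \<and> A X \<subseteq> carrier S \<and> X = cl (A X)" ..
  then have A: "finite (A X)" "A X \<subseteq> carrier S" "X = cl (A X)" if "X \<in> \<A>" for X
    using that by auto
  have sub: "A X \<subseteq> X" if "X \<in> \<A>" for X
    using subset_cl[OF A(2)[OF that]] A(3)[OF that] by simp
  have "compatible_up_to_cover S (\<Union> (A ` \<A>))"
    unfolding compatible_iff
  proof (intro conjI ballI)
    show "\<Union> (A ` \<A>) \<subseteq> carrier S"
      using A(2) by blast
    fix s t assume "s \<in> \<Union> (A ` \<A>)" "t \<in> \<Union> (A ` \<A>)"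
    then obtain X Y where XY: "X \<in> \<A>" "Y \<in> \<A>" "s \<in> X" "t \<in> Y"
      using sub by blast
    \<comment> \<open>Idempotents of \<open>D\<close> are subsets of \<open>Q\<close>, so
      compatibility in \<open>D\<close> turns into compatibility up to covers of the elements
      \<open>s\<close> and \<open>t\<close>.\<close>
    then have "X\<^sup>\<star>\<^bsub>D\<^esub> \<cdot>\<^bsub>D\<^esub> Y \<in> idems D" "X \<cdot>\<^bsub>D\<^esub> Y\<^sup>\<star>\<^bsub>D\<^esub> \<in> idems D"
      using comp unfolding compatible_def by auto
    then have "sg_inv S ` X \<cdot>\<^bsub>D\<^esub> Y \<subseteq> Q" "X \<cdot>\<^bsub>D\<^esub> sg_inv S ` Y \<subseteq> Q"
      using XY \<A> by (simp_all add: D_idem_iff D_inv)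
    moreover have "s\<^sup>\<star> \<cdot> t \<in> sg_inv S ` X \<cdot>\<^bsub>D\<^esub> Y" "s \<cdot> t\<^sup>\<star> \<in> X \<cdot>\<^bsub>D\<^esub> sg_inv S ` Y"
      using XY \<A> by (auto intro!: D_mult_mem D_inv_closed)
    ultimately show "s\<^sup>\<star> \<cdot> t \<in> Q" "s \<cdot> t\<^sup>\<star> \<in> Q"
      by auto
  qed
  then have "cl (\<Union> (A ` \<A>)) \<in> carrier D"
    using fin A(1) by (intro D_memI) auto
  moreover have "cl (\<Union> (A ` \<A>)) = cl (\<Union>\<A>)"
  proof
    show "cl (\<Union> (A ` \<A>)) \<subseteq> cl (\<Union>\<A>)"
      using sub by (intro cl_mono) blast
    have "X \<subseteq> cl (\<Union> (A ` \<A>))" if "X \<in> \<A>" for X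
      using A(3)[OF that] cl_mono[of "A X" "\<Union> (A ` \<A>)"] that by auto
    then show "cl (\<Union>\<A>) \<subseteq> cl (\<Union> (A ` \<A>))"
      using A(2) by (intro cl_least) blast+
  qed
  ultimately show ?thesis
    by simp
qed

lemma D_joinI:
  assumes "cl (\<Union>\<A>) \<in> carrier D" "\<A> \<subseteq> carrier D"
  shows "is_join D \<A> (cl (\<Union>\<A>))"
proof -
  have "\<Union>\<A> \<subseteq> carrier S"
    using assms D_subset by blast
  then have "X \<subseteq> cl (\<Union>\<A>)" if "X \<in> \<A>" for X
    using subset_cl that by blast
  moreover have "cl (\<Union>\<A>) \<subseteq> Z" if "Z \<in> carrier D" "\<forall>X \<in> \<A>. X \<subseteq> Z" for Z
    using that by (intro D_cl_least) auto
  ultimately show ?thesis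
    unfolding is_join_def using assms by (simp add: D_le_iff subset_eq[of \<A>])
qed

lemma D_join_eq:
  assumes "finite \<A>" "compatible D \<A>" "is_join D \<A> J"
  shows "J = cl (\<Union>\<A>)"
proof -
  interpret D: inverse_semigroup D by (rule D_inverse_semigroup)
  have "\<A> \<subseteq> carrier D"
    using assms(2) unfolding compatible_def by blast
  then show ?thesis
    using D.join_unique[OF assms(3) D_joinI] D_join_closed[OF assms(1,2)] by blast
qed

lemma D_distributive: "distributive_inverse_semigroup D"
proof -
  interpret D: inverse_semigroup D by (rule D_inverse_semigroup)
  show ?thesis
  proof
    fix \<A> assume \<A>: "finite \<A>" "\<A> \<noteq> {}" "compatible D \<A>"
    then have sub: "\<A> \<subseteq> carrier D"
      unfolding compatible_def by blast
    show "\<exists>J. is_join D \<A> J"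
      using D_joinI[OF D_join_closed[OF \<A>(1,3)] sub] by blast
    fix Y J assume Y: "Y \<in> carrier D" and J: "is_join D \<A> J"
    have J_eq: "J = cl (\<Union>\<A>)"
      using D_join_eq \<A> J by blast
    have Jc: "J \<in> carrier D"
      using J unfolding is_join_def by blast
    have le_J: "X \<preceq>\<^bsub>D\<^esub> J" if "X \<in> \<A>" for X
      using J that unfolding is_join_def by blast
    have Uc: "\<Union>\<A> \<subseteq> carrier S"
      using sub D_subset by blast
    \<comment> \<open>Being an upper bound is monotonicity; leastness uses that \<open>J\<close> is
      the closure of a union, over which the elementwise product distributes.\<close>
    have "Y \<cdot>\<^bsub>D\<^esub> J \<preceq>\<^bsub>D\<^esub> Z" if Z: "Z \<in> carrier D" and up: "\<And>X. X \<in> \<A> \<Longrightarrow> Y \<cdot>\<^bsub>D\<^esub> X \<preceq>\<^bsub>D\<^esub> Z" for Z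
    proof -
      have "Y \<odot> \<Union>\<A> \<subseteq> Z"
        using D_mult_mem[of _ Y] up sub Y Z by (fastforce simp: D_le_iff D.mult_closed)
      then show ?thesis
        using D_cl_least Z D_mult_left_cl[OF Y Uc] unfolding D_le_iff[OF D_mult_closed[OF Y Jc] Z]
        by (simp add: J_eq)
    qed
    then show "is_join D ((\<lambda>X. Y \<cdot>\<^bsub>D\<^esub> X) ` \<A>) (Y \<cdot>\<^bsub>D\<^esub> J)"
      unfolding is_join_def using Y Jc le_J by (auto intro: D.mult_mono)
    have "J \<cdot>\<^bsub>D\<^esub> Y \<preceq>\<^bsub>D\<^esub> Z" if Z: "Z \<in> carrier D" and up: "\<And>X. X \<in> \<A> \<Longrightarrow> X \<cdot>\<^bsub>D\<^esub> Y \<preceq>\<^bsub>D\<^esub> Z" for Z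
    proof -
      have "\<Union>\<A> \<odot> Y \<subseteq> Z"
        using D_mult_mem[of _ _ _ Y] up sub Y Z by (fastforce simp: D_le_iff D.mult_closed)
      then show ?thesis
        using D_cl_least Z D_mult_right_cl[OF Y Uc] unfolding D_le_iff[OF D_mult_closed[OF Jc Y] Z]
        by (simp add: J_eq)
    qed
    then show "is_join D ((\<lambda>X. X \<cdot>\<^bsub>D\<^esub> Y) ` \<A>) (J \<cdot>\<^bsub>D\<^esub> Y)"
      unfolding is_join_def using Y Jc le_J by (auto intro: D.mult_mono)
  qed
qed

section \<open>The canonical map into the completion\<close>

lemma completion_map_closed: "s \<in> carrier S \<Longrightarrow> completion_map S s \<in> carrier D"
  unfolding completion_map_def by (intro D_memI compatible_singleton) auto

lemma completion_map_mem: "s \<in> carrier S \<Longrightarrow> s \<in> completion_map S s"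
  unfolding completion_map_def using subset_cl by blast

lemma completion_map_hom: "sg_hom S D (completion_map S)"
proof -
  have "completion_map S (s \<cdot> t) = completion_map S s \<cdot>\<^bsub>D\<^esub> completion_map S t"
    if "s \<in> carrier S" "t \<in> carrier S" for s t
  proof -
    have "{s} \<odot> {t} = {s \<cdot> t}"
      by (auto simp: set_mult_def)
    then show ?thesis
      using that cl_set_mult_cl[of "{s}" "{t}"] by (simp add: completion_map_def D_mult)
  qed
  then show ?thesis
    unfolding sg_hom_def using completion_map_closed by auto
qed

lemma completion_map_cover_to_join: "cover_to_join_hom S D (completion_map S)"
proof -
  interpret D: inverse_semigroup D by (rule D_inverse_semigroup)
  have "is_join D (completion_map S ` A) (completion_map S s)"
    if s: "s \<in> carrier S" and cover: "is_cover S s A" for s A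
  proof -
    have A: "finite A" "\<And>a. a \<in> A \<Longrightarrow> a \<in> carrier S \<and> a \<preceq> s" "arrow S s A"
      using cover unfolding is_cover_def down_def by auto
    have "completion_map S s \<preceq>\<^bsub>D\<^esub> Z"
      if Z: "Z \<in> carrier D" and up: "\<And>a. a \<in> A \<Longrightarrow> completion_map S a \<preceq>\<^bsub>D\<^esub> Z" for Z
    proof -
      \<comment> \<open>Each \<open>a\<close> lies in its own image, so the closed set
        \<open>Z\<close> contains \<open>A\<close> and therefore also \<open>s\<close>, which
        \<open>A\<close> covers.\<close>
      have "A \<subseteq> Z"
        using up A completion_map_mem Z by (auto simp: D_le_iff completion_map_closed)
      then have "s \<in> Z"
        using clI[OF s A(1)] A(3) Z D_cl by blast
      then show ?thesis
        using Z D_cl_least s completion_map_closed by (simp add: D_le_iff completion_map_def)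
    qed
    then show ?thesis
      unfolding is_join_def using s A hom_mono[OF completion_map_hom] completion_map_closed by auto
  qed
  then show ?thesis
    unfolding cover_to_join_hom_def using completion_map_hom by blast
qed

lemma completion_map_zero_restricted: "zero_restricted S D (completion_map S)"
  unfolding zero_restricted_def D_zero using completion_map_mem by blast

text \<open>The map preserves products and inverses, and it sends an element of \<open>Q\<close> to
  a subset of \<open>Q\<close>, that is, to an idempotent. Elements compatible only up to covers
  thus become compatible in the completion.\<close>

lemma compatible_completion_map_image:
  assumes "compatible_up_to_cover S A"
  shows "compatible D (completion_map S ` A)"
proof -
  let ?\<delta> = "completion_map S"
  have A: "A \<subseteq> carrier S"
    by (rule compatible_closed[OF assms])
  have "(?\<delta> s)\<^sup>\<star>\<^bsub>D\<^esub> \<cdot>\<^bsub>D\<^esub> ?\<delta> t \<in> idems D \<and> ?\<delta> s \<cdot>\<^bsub>D\<^esub> (?\<delta> t)\<^sup>\<star>\<^bsub>D\<^esub> \<in> idems D"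
    if "s \<in> A" "t \<in> A" for s t
  proof -
    have c: "s \<in> carrier S" "t \<in> carrier S"
      using A that by auto
    have "s\<^sup>\<star> \<cdot> t \<in> Q" "s \<cdot> t\<^sup>\<star> \<in> Q"
      using assms that unfolding compatible_iff by auto
    then have "?\<delta> (s\<^sup>\<star> \<cdot> t) \<in> idems D" "?\<delta> (s \<cdot> t\<^sup>\<star>) \<in> idems D"
      unfolding D_idem_iff using completion_map_closed c
      by (simp_all add: completion_map_def cl_subset_Q)
    then show ?thesis
      using c completion_map_hom hom_inv[OF D_inverse_semigroup completion_map_hom]
      unfolding sg_hom_def by simp
  qed
  then show ?thesis
    unfolding compatible_def using A completion_map_closed by auto
qed

text \<open>With the previous lemma, every element of the completion is a join of finitely many
  compatible images, which is why a join-preserving map is determined by its values on them.\<close>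

lemma D_join_completion_map:
  assumes A: "finite A" "compatible_up_to_cover S A"
  shows "is_join D (completion_map S ` A) (cl A)"
proof -
  have c: "A \<subseteq> carrier S"
    using A compatible_closed by blast
  have "cl (\<Union> (completion_map S ` A)) = cl A"
  proof
    show "cl (\<Union> (completion_map S ` A)) \<subseteq> cl A"
      using c cl_mono[of "{a}" A for a] by (intro cl_least) (auto simp: completion_map_def)
    show "cl A \<subseteq> cl (\<Union> (completion_map S ` A))"
      using c completion_map_mem by (intro cl_mono) blast
  qed
  then show ?thesis
    using D_joinI[of "completion_map S ` A"] D_memI[OF A] c completion_map_closed by auto
qed

end

section \<open>The universal property\<close>

locale cover_to_join_map = inverse_meet_semigroup S + T: distributive_inverse_semigroup T
  for S :: "'a zsemigroup" (structure) and T :: "'b zsemigroup" +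
  fixes \<theta> :: "'a \<Rightarrow> 'b"
  assumes cover_to_join: "cover_to_join_hom S T \<theta>"
begin

section \<open>Cover-to-join maps on closures and compatible sets\<close>

lemma hom: "sg_hom S T \<theta>"
  using cover_to_join by (simp add: cover_to_join_hom_def)

lemma map_closed [simp]: "s \<in> carrier S \<Longrightarrow> \<theta> s \<in> carrier T"
  and map_mult: "\<lbrakk>s \<in> carrier S; t \<in> carrier S\<rbrakk> \<Longrightarrow> \<theta> (s \<cdot> t) = \<theta> s \<cdot>\<^bsub>T\<^esub> \<theta> t"
  using hom by (auto simp: sg_hom_def)

text \<open>An arrow from \<open>s\<close> to \<open>A\<close> does not require \<open>A\<close> to
  lie below \<open>s\<close>, whereas a cover does. The meets of \<open>s\<close> with the members
  \<open>a\<close> of \<open>A\<close> form a cover of \<open>s\<close>, and their images lie below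
  the elements \<open>\<theta> a\<close>.\<close>

lemma map_arrow_le:
  assumes s: "s \<in> carrier S" and A: "finite A" "A \<subseteq> carrier S" "arrow S s A"
    and z: "z \<in> carrier T" and up: "\<And>a. a \<in> A \<Longrightarrow> \<theta> a \<preceq>\<^bsub>T\<^esub> z"
  shows "\<theta> s \<preceq>\<^bsub>T\<^esub> z"
proof -
  let ?B = "meet S s ` A"
  have "\<exists>b \<in> ?B. \<exists>y. y \<noteq> \<zero> \<and> y \<preceq> x \<and> y \<preceq> b" if x: "x \<preceq> s" "x \<noteq> \<zero>" for x
  proof -
    obtain a y where y: "a \<in> A" "y \<noteq> \<zero>" "y \<preceq> x" "y \<preceq> a"
      using A(3) x arrow_iff[OF s A(2)] by blast
    have "y \<preceq> s"
      using le_trans[OF y(3) x(1) s] .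
    moreover have "y \<in> carrier S"
      using \<open>y \<preceq> s\<close> s by (rule le_closed)
    ultimately have "y \<preceq> meet S s a"
      using y s A(2) by (intro meet_greatest) auto
    then show ?thesis
      using y by blast
  qed
  then have "arrow S s ?B"
    using s A(2) by (subst arrow_iff) auto
  then have "is_cover S s ?B"
    unfolding is_cover_def down_def using A s meet_le1 by auto
  then have "is_join T (\<theta> ` ?B) (\<theta> s)"
    using cover_to_join s by (auto simp: cover_to_join_hom_def)
  moreover have "\<theta> (meet S s a) \<preceq>\<^bsub>T\<^esub> z" if "a \<in> A" for a
  proof (rule T.le_trans[OF _ up[OF that] z])
    show "\<theta> (meet S s a) \<preceq>\<^bsub>T\<^esub> \<theta> a"
      using that s A(2) meet_le2 by (intro hom_mono[OF hom]) auto
  qed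
  ultimately show ?thesis
    using z unfolding is_join_def by blast
qed

lemma map_cl_le:
  assumes "s \<in> cl X" "X \<subseteq> carrier S" "z \<in> carrier T" "\<And>x. x \<in> X \<Longrightarrow> \<theta> x \<preceq>\<^bsub>T\<^esub> z"
  shows "\<theta> s \<preceq>\<^bsub>T\<^esub> z"
proof -
  obtain F where "s \<in> carrier S" "finite F" "F \<subseteq> X" "arrow S s F"
    using assms(1) by (rule clE)
  then show ?thesis
    using assms by (intro map_arrow_le[of s F]) auto
qed

text \<open>The images of \<open>X\<close> and of its closure have the same upper bounds. Joins in
  \<open>T\<close> are provided for finite compatible sets, so the join over an infinite closed set
  is found on finite generators.\<close>

lemma is_join_cl_iff:
  assumes "X \<subseteq> carrier S"
  shows "is_join T (\<theta> ` cl X) j \<longleftrightarrow> is_join T (\<theta> ` X) j"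
proof -
  have "(\<forall>x \<in> cl X. \<theta> x \<preceq>\<^bsub>T\<^esub> z) \<longleftrightarrow> (\<forall>x \<in> X. \<theta> x \<preceq>\<^bsub>T\<^esub> z)" if "z \<in> carrier T" for z
    using that assms subset_cl[OF assms] map_cl_le by blast
  then show ?thesis
    unfolding is_join_def by auto
qed

lemma map_Q:
  assumes "u \<in> Q"
  shows "\<theta> u \<in> idems T"
proof -
  obtain m where m: "m \<in> idems S" "m \<preceq> u" "arrow S u {m}"
    using assms by (rule QE)
  have "\<theta> u \<preceq>\<^bsub>T\<^esub> \<theta> m"
    using m cl_closedD[OF assms] by (intro map_arrow_le[of u "{m}"]) auto
  then show ?thesis
    using hom_idem[OF hom m(1)] T.le_idem by blast
qed

lemma compatible_map_image:
  assumes "compatible_up_to_cover S A"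
  shows "compatible T (\<theta> ` A)"
proof -
  have "(\<theta> s)\<^sup>\<star>\<^bsub>T\<^esub> \<cdot>\<^bsub>T\<^esub> \<theta> t \<in> idems T \<and> \<theta> s \<cdot>\<^bsub>T\<^esub> (\<theta> t)\<^sup>\<star>\<^bsub>T\<^esub> \<in> idems T" if "s \<in> A" "t \<in> A" for s t
  proof -
    have "s \<in> carrier S" "t \<in> carrier S"
      using compatible_closed[OF assms] that by auto
    moreover have "\<theta> (s\<^sup>\<star> \<cdot> t) \<in> idems T" "\<theta> (s \<cdot> t\<^sup>\<star>) \<in> idems T"
      using assms that map_Q unfolding compatible_iff by auto
    ultimately show ?thesis
      by (simp add: map_mult hom_inv[OF T.inverse_semigroup_axioms hom])
  qed
  then show ?thesis
    unfolding compatible_def using compatible_closed[OF assms] by auto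
qed

section \<open>Construction of the extension\<close>

lemma T_join_empty: "is_join T {} \<zero>\<^bsub>T\<^esub>"
  unfolding is_join_def by auto

text \<open>Taking the join over all of \<open>X\<close> makes the value independent of a choice of
  generators. The restriction to \<open>carrier D\<close> makes the function extensional, since
  uniqueness is asserted among extensional functions.\<close>

definition extension :: "'a set \<Rightarrow> 'b" where
  "extension = (\<lambda>X \<in> carrier D. THE j. is_join T (\<theta> ` X) j)"

lemma extension_eqI: "\<lbrakk>X \<in> carrier D; is_join T (\<theta> ` X) j\<rbrakk> \<Longrightarrow> extension X = j"
  unfolding extension_def using T.join_unique by (simp add: the_equality)

lemma extension_join:
  assumes X: "X \<in> carrier D"
  shows "is_join T (\<theta> ` X) (extension X)"
proof -
  obtain A where A: "finite A" "compatible_up_to_cover S A" "A \<subseteq> carrier S" "X = cl A"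
    using X by (rule D_memE)
  \<comment> \<open>The existence law for joins concerns non-empty sets; an empty set of generators
    has join zero.\<close>
  have "\<exists>j. is_join T (\<theta> ` A) j"
    using A(1) T_join_empty T.ex_join compatible_map_image[OF A(2)] by (cases "A = {}") auto
  then obtain j where "is_join T (\<theta> ` X) j"
    using A by (auto simp: is_join_cl_iff)
  then show ?thesis
    using extension_eqI[OF X] by simp
qed

lemma extension_closed [simp]: "X \<in> carrier D \<Longrightarrow> extension X \<in> carrier T"
  using extension_join unfolding is_join_def by blast

lemma map_le_extension: "\<lbrakk>x \<in> X; X \<in> carrier D\<rbrakk> \<Longrightarrow> \<theta> x \<preceq>\<^bsub>T\<^esub> extension X"
  using extension_join unfolding is_join_def by blast

lemma extension_le:
  "\<lbrakk>X \<in> carrier D; z \<in> carrier T; \<And>x. x \<in> X \<Longrightarrow> \<theta> x \<preceq>\<^bsub>T\<^esub> z\<rbrakk> \<Longrightarrow> extension X \<preceq>\<^bsub>T\<^esub> z"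
  using extension_join unfolding is_join_def by blast

lemma extension_completion_map:
  assumes "s \<in> carrier S"
  shows "extension (completion_map S s) = \<theta> s"
proof (rule extension_eqI)
  have "is_join T (\<theta> ` {s}) (\<theta> s)"
    using assms by (auto simp: is_join_def)
  then show "is_join T (\<theta> ` completion_map S s) (\<theta> s)"
    using assms unfolding completion_map_def by (subst is_join_cl_iff) auto
qed (rule completion_map_closed[OF assms])

text \<open>Distributivity in \<open>T\<close> is used twice: first over the images of
  \<open>A\<close> in the left factor, then, for each fixed \<open>\<theta> a\<close>, over the
  images of \<open>B\<close>. What remains are the values of \<open>\<theta>\<close> on
  \<open>A \<odot> B\<close>.\<close>

lemma extension_mult:
  assumes X: "X \<in> carrier D" and Y: "Y \<in> carrier D"
  shows "extension (X \<cdot>\<^bsub>D\<^esub> Y) = extension X \<cdot>\<^bsub>T\<^esub> extension Y"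
proof (rule extension_eqI)
  show "X \<cdot>\<^bsub>D\<^esub> Y \<in> carrier D"
    using X Y by (rule D_mult_closed)
  obtain A where A: "finite A" "compatible_up_to_cover S A" "A \<subseteq> carrier S" "X = cl A"
    using X by (rule D_memE)
  obtain B where B: "finite B" "compatible_up_to_cover S B" "B \<subseteq> carrier S" "Y = cl B"
    using Y by (rule D_memE)
  let ?x = "extension X" and ?y = "extension Y"
  have x: "is_join T (\<theta> ` A) ?x"
    using extension_join[OF X] A by (simp add: is_join_cl_iff)
  have y: "is_join T (\<theta> ` B) ?y"
    using extension_join[OF Y] B by (simp add: is_join_cl_iff)
  have "is_join T (\<theta> ` (A \<odot> B)) (?x \<cdot>\<^bsub>T\<^esub> ?y)"
    unfolding is_join_def
  proof (intro conjI ballI impI)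
    show "?x \<cdot>\<^bsub>T\<^esub> ?y \<in> carrier T"
      using X Y by simp
    show "w \<preceq>\<^bsub>T\<^esub> ?x \<cdot>\<^bsub>T\<^esub> ?y" if "w \<in> \<theta> ` (A \<odot> B)" for w
    proof -
      obtain a b where ab: "a \<in> A" "b \<in> B" "w = \<theta> (a \<cdot> b)"
        using \<open>w \<in> _\<close> by auto
      then have "w = \<theta> a \<cdot>\<^bsub>T\<^esub> \<theta> b"
        using A(3) B(3) map_mult by auto
      then show ?thesis
        using ab x y X Y unfolding is_join_def by (auto intro: T.mult_mono)
    qed
    fix z assume z: "z \<in> carrier T" and up: "\<forall>w \<in> \<theta> ` (A \<odot> B). w \<preceq>\<^bsub>T\<^esub> z"
    show "?x \<cdot>\<^bsub>T\<^esub> ?y \<preceq>\<^bsub>T\<^esub> z"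
    proof (cases "A = {} \<or> B = {}")
      \<comment> \<open>Distributivity is stated for non-empty sets; here an empty set of generators
        makes one factor zero.\<close>
      case True
      then have "?x = \<zero>\<^bsub>T\<^esub> \<or> ?y = \<zero>\<^bsub>T\<^esub>"
        using x y T.join_unique[OF T_join_empty] by auto
      then show ?thesis
        using X Y z by auto
    next
      case False
      have "\<theta> a \<cdot>\<^bsub>T\<^esub> ?y \<preceq>\<^bsub>T\<^esub> z" if a: "a \<in> A" for a
      proof -
        have ac: "a \<in> carrier S"
          using a A(3) by blast
        have "is_join T ((\<lambda>w. \<theta> a \<cdot>\<^bsub>T\<^esub> w) ` \<theta> ` B) (\<theta> a \<cdot>\<^bsub>T\<^esub> ?y)"
          using False B(1) compatible_map_image[OF B(2)] y ac by (intro T.distrib_left) auto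
        moreover have "\<theta> a \<cdot>\<^bsub>T\<^esub> \<theta> b \<preceq>\<^bsub>T\<^esub> z" if "b \<in> B" for b
        proof -
          have "\<theta> (a \<cdot> b) \<preceq>\<^bsub>T\<^esub> z"
            using up a that by blast
          then show ?thesis
            using map_mult ac that B(3) by (metis subsetD)
        qed
        ultimately show ?thesis
          using z unfolding is_join_def by blast
      qed
      moreover have "is_join T ((\<lambda>w. w \<cdot>\<^bsub>T\<^esub> ?y) ` \<theta> ` A) (?x \<cdot>\<^bsub>T\<^esub> ?y)"
        using False A(1) compatible_map_image[OF A(2)] x Y by (intro T.distrib_right) auto
      ultimately show ?thesis
        using z unfolding is_join_def by blast
    qed
  qed
  moreover have "X \<cdot>\<^bsub>D\<^esub> Y = cl (A \<odot> B)"
    using A B by (simp add: D_mult cl_set_mult_cl)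
  ultimately show "is_join T (\<theta> ` (X \<cdot>\<^bsub>D\<^esub> Y)) (?x \<cdot>\<^bsub>T\<^esub> ?y)"
    using A(3) B(3) by (simp add: is_join_cl_iff set_mult_closed)
qed

lemma extension_join_preserving: "join_preserving_hom D T extension"
proof -
  have "is_join T (extension ` \<A>) (extension J)"
    if fin: "finite \<A>" and comp: "compatible D \<A>" and join: "is_join D \<A> J" for \<A> J
    unfolding is_join_def
  proof (intro conjI ballI impI)
    have \<A>: "\<A> \<subseteq> carrier D"
      using comp unfolding compatible_def by blast
    have J_eq: "J = cl (\<Union>\<A>)"
      by (rule D_join_eq[OF fin comp join])
    have J: "J \<in> carrier D"
      using join unfolding is_join_def by blast
    then show "extension J \<in> carrier T"
      by simp
    have Uc: "\<Union>\<A> \<subseteq> carrier S"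
      using \<A> D_subset by blast
    show "w \<preceq>\<^bsub>T\<^esub> extension J" if w: "w \<in> extension ` \<A>" for w
    proof -
      obtain X where X: "X \<in> \<A>" "w = extension X"
        using w by blast
      then have "X \<subseteq> J"
        using subset_cl[OF Uc] J_eq by blast
      then show ?thesis
        using X \<A> J map_le_extension[of _ J] by (auto intro!: extension_le)
    qed
    fix z assume z: "z \<in> carrier T" and up: "\<forall>w \<in> extension ` \<A>. w \<preceq>\<^bsub>T\<^esub> z"
    have "\<theta> x \<preceq>\<^bsub>T\<^esub> z" if "X \<in> \<A>" "x \<in> X" for x X
    proof (rule T.le_trans[OF map_le_extension])
      show "extension X \<preceq>\<^bsub>T\<^esub> z"
        using up that by blast
    qed (use that \<A> z in auto)
    \<comment> \<open>The bound for \<open>\<theta>\<close> on the union of the family extends to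
      its closure, which is \<open>J\<close>.\<close>
    then have "\<theta> x \<preceq>\<^bsub>T\<^esub> z" if "x \<in> J" for x
      using map_cl_le[OF _ Uc z] that unfolding J_eq by blast
    then show "extension J \<preceq>\<^bsub>T\<^esub> z"
      using J z by (intro extension_le)
  qed
  then show ?thesis
    unfolding join_preserving_hom_def sg_hom_def using extension_mult by auto
qed

text \<open>\<open>X\<close> is the join of the finite compatible set of images of its generators,
  so \<open>\<phi>\<close> must send it to the join of \<open>\<theta>\<close> over the generators,
  which is the value of \<open>extension\<close>.\<close>

lemma extension_unique:
  assumes ext: "\<phi> \<in> extensional (carrier D)" and jp: "join_preserving_hom D T \<phi>"
    and \<phi>: "\<And>s. s \<in> carrier S \<Longrightarrow> \<phi> (completion_map S s) = \<theta> s"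
  shows "\<phi> = extension"
proof (rule extensionalityI[OF ext])
  show "extension \<in> extensional (carrier D)"
    by (simp add: extension_def)
  fix X assume X: "X \<in> carrier D"
  then obtain A where A: "finite A" "compatible_up_to_cover S A" "A \<subseteq> carrier S" "X = cl A"
    by (rule D_memE)
  have "is_join T (\<phi> ` completion_map S ` A) (\<phi> X)"
    using jp A D_join_completion_map[OF A(1,2)] compatible_completion_map_image[OF A(2)]
    unfolding join_preserving_hom_def by blast
  moreover have "\<phi> ` completion_map S ` A = \<theta> ` A"
    using \<phi> A(3) by (force simp: image_image)
  ultimately have "is_join T (\<theta> ` X) (\<phi> X)"
    using A by (simp add: is_join_cl_iff)
  then show "\<phi> X = extension X"
    using extension_eqI[OF X] by simp
qed

end

theorem mainTheorem1:
  fixes S :: "'a zsemigroup"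
  assumes "inverse_meet_semigroup S"
  shows "distributive_inverse_semigroup (distr_completion S) \<and>
    inverse_meet_semigroup (distr_completion S) \<and>
    cover_to_join_hom S (distr_completion S) (completion_map S) \<and>
    zero_restricted S (distr_completion S) (completion_map S) \<and>
    (\<forall>(T :: 'b zsemigroup) \<theta>.
       distributive_inverse_semigroup T \<and> cover_to_join_hom S T \<theta> \<longrightarrow>
       (\<exists>!\<phi>. \<phi> \<in> extensional (carrier (distr_completion S)) \<and>
          join_preserving_hom (distr_completion S) T \<phi> \<and>
          (\<forall>s \<in> carrier S. \<phi> (completion_map S s) = \<theta> s)))"
proof (intro conjI allI impI)
  interpret inverse_meet_semigroup S by (rule assms)
  show "distributive_inverse_semigroup D" "inverse_meet_semigroup D"
    "cover_to_join_hom S D (completion_map S)" "zero_restricted S D (completion_map S)"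
    by (fact D_distributive D_inverse_meet_semigroup completion_map_cover_to_join
        completion_map_zero_restricted)+
  fix T :: "'b zsemigroup" and \<theta>
  assume "distributive_inverse_semigroup T \<and> cover_to_join_hom S T \<theta>"
  then interpret cover_to_join_map S T \<theta>
    by (simp add: cover_to_join_map_def cover_to_join_map_axioms_def assms)
  show "\<exists>!\<phi>. \<phi> \<in> extensional (carrier D) \<and> join_preserving_hom D T \<phi> \<and>
      (\<forall>s \<in> carrier S. \<phi> (completion_map S s) = \<theta> s)"
    using extension_join_preserving extension_completion_map extension_unique
    by (intro ex1I[of _ extension]) (auto simp: extension_def)
qed

end
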